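(* Let $(M,D,g)$ be a pseudo-Euclidean manifold of dimension $d\ge 2$ and let $\nabla$ be a hybrid connection on it, with hybrid potential $\psi$. Then the following three pseudo-Riemannian metrics on $\psi^{-1}(\mathbb{R}^* )$ belong to the same conformal class: (i) the Hessian metric $g$; (ii) $\frac{d-1}{|\psi|}\,g$, which coincides with the Ricci tensor $\mathrm{Ric}(\nabla)$ of $\nabla$ at points of $M$ where $\psi>0$ and with $-\mathrm{Ric}(\nabla)$ at points of $M$ where $\psi<0$; (iii) the isochrone metric $\frac{1}{\psi^4}\,g$. Moreover, $\nabla$ preserves the volume form $\frac{\mathrm{Vol}}{\psi^{d+1}}$, where $\mathrm{Vol}$ is the canonical volume form $dx_1\wedge\cdots\wedge dx_d$ in any affine chart with respect to $D$.
   Context: All manifolds, connections and metrics are smooth; "metric" means pseudo-Riemannian metric. Two metrics are in the same conformal class if one is the product of the other by a positive function. An affine manifold $(M,D)$ is a manifold with a flat affine connection $D$ (torsion-free, zero curvature); affine charts are charts in which $D$ is the canonical connection of $\mathbb{R}^d$. The Hessian $H(f)$ of a function $f$ is the $(0,2)$-tensor with matrix $\left(\frac{\partial^2 f}{\partial x_i\partial x_j}\right)$ in affine charts. A Hessian manifold $(M,D,g)$: $M$ connected of dimension $d\ge2$, $D$ a flat affine connection, $g$ a pseudo-Riemannian metric locally of the form $H(\psi)$. It is a pseudo-Euclidean manifold if moreover $g$ is constant in the affine charts of $D$. A hybrid connection $\nabla$ on $(M,D,g)$ is a symmetric (torsion-free) affine connection such that: (1) its unparameterized geodesics are those of $D$;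 (2) it is incompressible: near every point there is a non-vanishing volume form locally preserved by its parallel transport; (3) it is infinitesimally conformal: in any affine chart its holonomy around an arbitrarily small planar rectangle of area $\mathcal{A}$ is $\mathrm{Id}+\mathcal{A}\mathcal{M}+o(\mathcal{A})$ with $\mathcal{M}$ an infinitesimal similarity of $g$, i.e. $g(\mathcal{M}v,w)+g(v,\mathcal{M}w)=c\,g(v,w)$ for some $c\in\mathbb{R}$; (4) its curvature tensor vanishes at no point. Every hybrid connection $\nabla$ has a unique hybrid potential: the unique smooth function $\psi:M\to\mathbb{R}^*=\mathbb{R}\setminus\{0\}$ such that $H(\psi)=g$ and $\nabla_u v = D_u v - \frac{d\psi(u)v+d\psi(v)u}{\psi}$ for all tangent vectors $u$ and local vector fields $v$. The isochrone metric associated with $(M,D,g)$ and $\nabla$ is, by definition, $\frac{1}{\psi^4}g$. Conventions: $R(X,Y)Z=\nabla_X\nabla_YZ-\nabla_Y\nabla_XZ-\nabla_{[X,Y]}Z$, with coefficients $R(X,Y)Z=\sum R_{ijk}^l X_iY_jZ_k e_l$, and $\mathrm{Ric}_{jk}=\sum_i R_{ijk}^i$. *)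

theory Defs
  imports "HOL-Analysis.Analysis"
begin

section \<open>Smooth functions and smooth manifolds\<close>

primrec times_differentiable_on ::
  "nat \<Rightarrow> 'a::real_normed_vector set \<Rightarrow> ('a \<Rightarrow> 'b::real_normed_vector) \<Rightarrow> bool" where
  "times_differentiable_on 0 S f \<longleftrightarrow> continuous_on S f"
| "times_differentiable_on (Suc n) S f \<longleftrightarrow>
     (\<forall>x\<in>S. f differentiable (at x)) \<and>
     (\<forall>v. times_differentiable_on n S (\<lambda>x. frechet_derivative f (at x) v))"

text \<open>Only used for open \<open>S\<close>.\<close>
definition smooth_on :: "'a::real_normed_vector set \<Rightarrow> ('a \<Rightarrow> 'b::real_normed_vector) \<Rightarrow> bool" where
  "smooth_on S f \<longleftrightarrow> (\<forall>n. times_differentiable_on n S f)"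

text \<open>A chart is a pair of its domain and its coordinate map; the values of the
  coordinate map outside of the domain are irrelevant.\<close>
type_synonym ('a, 'd) chart = "'a set \<times> ('a \<Rightarrow> real^'d)"

abbreviation cdom :: "('a, 'd::finite) chart \<Rightarrow> 'a set" where "cdom c \<equiv> fst c"

abbreviation coord :: "('a, 'd::finite) chart \<Rightarrow> 'a \<Rightarrow> real^'d" where "coord c \<equiv> snd c"

definition pt :: "('a, 'd::finite) chart \<Rightarrow> real^'d \<Rightarrow> 'a" where
  "pt c = inv_into (cdom c) (coord c)"

definition transition :: "('a, 'd::finite) chart \<Rightarrow> ('a, 'd) chart \<Rightarrow> real^'d \<Rightarrow> real^'d" where
  "transition c c' = (\<lambda>x. coord c' (pt c x))"

definition is_chart :: "'a topology \<Rightarrow> ('a, 'd::finite) chart \<Rightarrow> bool" where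
  "is_chart X c \<longleftrightarrow> openin X (cdom c) \<and> open (coord c ` cdom c) \<and>
     homeomorphic_map (subtopology X (cdom c)) (top_of_set (coord c ` cdom c)) (coord c)"

definition compatible :: "('a, 'd::finite) chart \<Rightarrow> ('a, 'd) chart \<Rightarrow> bool" where
  "compatible c c' \<longleftrightarrow>
     smooth_on (coord c ` (cdom c \<inter> cdom c')) (transition c c') \<and>
     smooth_on (coord c' ` (cdom c \<inter> cdom c')) (transition c' c)"

text \<open>The smooth structure is given by a maximal atlas \<open>A\<close>.\<close>
definition smooth_manifold :: "'a topology \<Rightarrow> ('a, 'd::finite) chart set \<Rightarrow> bool" where
  "smooth_manifold X A \<longleftrightarrow> Hausdorff_space X \<and> second_countable X \<and>
     (\<forall>c\<in>A. is_chart X c) \<and> \<Union> (cdom ` A) = topspace X \<and>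
     (\<forall>c\<in>A. \<forall>c'\<in>A. compatible c c') \<and>
     (\<forall>c. is_chart X c \<and> (\<forall>c'\<in>A. compatible c c') \<longrightarrow> c \<in> A)"

definition smooth_fun_on :: "('a, 'd::finite) chart set \<Rightarrow> 'a set \<Rightarrow> ('a \<Rightarrow> real) \<Rightarrow> bool" where
  "smooth_fun_on A W f \<longleftrightarrow> (\<forall>c\<in>A. smooth_on (coord c ` (cdom c \<inter> W)) (\<lambda>x. f (pt c x)))"

text \<open>The differential of \<open>f\<close> at the point with coordinates \<open>x\<close> in the chart \<open>c\<close>,
  applied to the tangent vector with components \<open>v\<close>.\<close>
definition differential :: "('a \<Rightarrow> real) \<Rightarrow> ('a, 'd::finite) chart \<Rightarrow> real^'d \<Rightarrow> real^'d \<Rightarrow> real" where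
  "differential f c x v = frechet_derivative (\<lambda>y. f (pt c y)) (at x) v"

text \<open>The differential of a change of charts, i.e. the change of components of
  tangent vectors.\<close>
abbreviation dtrans ::
  "('a, 'd::finite) chart \<Rightarrow> ('a, 'd) chart \<Rightarrow> real^'d \<Rightarrow> real^'d \<Rightarrow> real^'d" where
  "dtrans c c' x \<equiv> frechet_derivative (transition c c') (at x)"


section \<open>Tensors of type (0,2) and pseudo-Riemannian metrics\<close>

text \<open>A (0,2)-tensor field \<open>h\<close> is given by its coordinate expressions: \<open>h c x v w\<close> is its value
  at the point with coordinates \<open>x\<close> in the chart \<open>c\<close> on the tangent vectors with
  components \<open>v\<close> and \<open>w\<close> in this chart.\<close>
type_synonym ('a, 'd) tensor2 = "('a, 'd) chart \<Rightarrow> real^'d \<Rightarrow> real^'d \<Rightarrow> real^'d \<Rightarrow> real"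

definition tensor2_field ::
  "('a, 'd::finite) chart set \<Rightarrow> 'a set \<Rightarrow> ('a, 'd) tensor2 \<Rightarrow> bool" where
  "tensor2_field A W h \<longleftrightarrow>
     (\<forall>c\<in>A. \<forall>x\<in>coord c ` (cdom c \<inter> W). bilinear (h c x)) \<and>
     (\<forall>c\<in>A. \<forall>v w. smooth_on (coord c ` (cdom c \<inter> W)) (\<lambda>x. h c x v w)) \<and>
     (\<forall>c\<in>A. \<forall>c'\<in>A. \<forall>x\<in>coord c ` (cdom c \<inter> cdom c' \<inter> W). \<forall>v w.
        h c x v w = h c' (transition c c' x) (dtrans c c' x v) (dtrans c c' x w))"

definition eq_tensor2_on ::
  "('a, 'd::finite) chart set \<Rightarrow> 'a set \<Rightarrow> ('a, 'd) tensor2 \<Rightarrow> ('a, 'd) tensor2 \<Rightarrow> bool" where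
  "eq_tensor2_on A W h k \<longleftrightarrow>
     (\<forall>c\<in>A. \<forall>x\<in>coord c ` (cdom c \<inter> W). \<forall>v w. h c x v w = k c x v w)"

definition scale :: "('a \<Rightarrow> real) \<Rightarrow> ('a, 'd::finite) tensor2 \<Rightarrow> ('a, 'd) tensor2" where
  "scale f h = (\<lambda>c x v w. f (pt c x) * h c x v w)"

text \<open>A pseudo-Riemannian metric on the open subset \<open>W\<close>.\<close>
definition metric_on :: "('a, 'd::finite) chart set \<Rightarrow> 'a set \<Rightarrow> ('a, 'd) tensor2 \<Rightarrow> bool" where
  "metric_on A W g \<longleftrightarrow> tensor2_field A W g \<and>
     (\<forall>c\<in>A. \<forall>x\<in>coord c ` (cdom c \<inter> W).
        (\<forall>v w. g c x v w = g c x w v) \<and>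
        (\<forall>v. (\<forall>w. g c x v w = 0) \<longrightarrow> v = 0))"

definition same_conformal_class ::
  "('a, 'd::finite) chart set \<Rightarrow> 'a set \<Rightarrow> ('a, 'd) tensor2 \<Rightarrow> ('a, 'd) tensor2 \<Rightarrow> bool" where
  "same_conformal_class A W g h \<longleftrightarrow> metric_on A W g \<and> metric_on A W h \<and>
     (\<exists>f. (\<forall>p\<in>W. 0 < f p) \<and> eq_tensor2_on A W h (scale f g))"


section \<open>Affine connections\<close>

text \<open>A connection on an open subset of the Euclidean space is given by its Christoffel map:
  \<open>G x v w\<close> is the vector with components \<open>\<Sum>i j. G\<^sub>i\<^sub>j\<^sup>k(x) v\<^sub>i w\<^sub>j\<close>. A connection on a manifold
  is given by its Christoffel maps in all charts.\<close>
type_synonym 'd christoffel = "real^'d \<Rightarrow> real^'d \<Rightarrow> real^'d \<Rightarrow> real^'d"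

type_synonym ('a, 'd) connection = "('a, 'd) chart \<Rightarrow> 'd christoffel"

definition covd ::
  "'d::finite christoffel \<Rightarrow> (real^'d \<Rightarrow> real^'d) \<Rightarrow> (real^'d \<Rightarrow> real^'d) \<Rightarrow> real^'d \<Rightarrow> real^'d" where
  "covd G U V x = frechet_derivative V (at x) (U x) + G x (U x) (V x)"

definition lie_bracket ::
  "(real^'d::finite \<Rightarrow> real^'d) \<Rightarrow> (real^'d \<Rightarrow> real^'d) \<Rightarrow> real^'d \<Rightarrow> real^'d" where
  "lie_bracket U V x = frechet_derivative V (at x) (U x) - frechet_derivative U (at x) (V x)"

definition torsion ::
  "'d::finite christoffel \<Rightarrow> (real^'d \<Rightarrow> real^'d) \<Rightarrow> (real^'d \<Rightarrow> real^'d) \<Rightarrow> real^'d \<Rightarrow> real^'d" where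
  "torsion G U V x = covd G U V x - covd G V U x - lie_bracket U V x"

definition curvature ::
  "'d::finite christoffel \<Rightarrow> (real^'d \<Rightarrow> real^'d) \<Rightarrow> (real^'d \<Rightarrow> real^'d) \<Rightarrow> (real^'d \<Rightarrow> real^'d) \<Rightarrow>
     real^'d \<Rightarrow> real^'d" where
  "curvature G U V W x =
     covd G U (covd G V W) x - covd G V (covd G U W) x - covd G (lie_bracket U V) W x"

text \<open>Torsion and curvature are tensors, so that their values on vectors are obtained by
  extending these vectors to constant vector fields in the chart. In particular the coefficient
  \<open>R\<^sub>i\<^sub>j\<^sub>k\<^sup>l\<close> is \<open>riemann G x (axis i 1) (axis j 1) (axis k 1) $ l\<close>.\<close>
definition torsion_tensor :: "'d::finite christoffel \<Rightarrow> real^'d \<Rightarrow> real^'d \<Rightarrow> real^'d \<Rightarrow> real^'d" where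
  "torsion_tensor G x u v = torsion G (\<lambda>_. u) (\<lambda>_. v) x"

definition riemann ::
  "'d::finite christoffel \<Rightarrow> real^'d \<Rightarrow> real^'d \<Rightarrow> real^'d \<Rightarrow> real^'d \<Rightarrow> real^'d" where
  "riemann G x u v w = curvature G (\<lambda>_. u) (\<lambda>_. v) (\<lambda>_. w) x"

definition ricci :: "('a, 'd::finite) connection \<Rightarrow> ('a, 'd) tensor2" where
  "ricci G = (\<lambda>c x v w. \<Sum>i\<in>UNIV. riemann (G c) x (axis i 1) v w $ i)"

text \<open>The last clause is the usual transformation law of Christoffel symbols.\<close>
definition is_connection ::
  "('a, 'd::finite) chart set \<Rightarrow> ('a, 'd) connection \<Rightarrow> bool" where
  "is_connection A G \<longleftrightarrow>
     (\<forall>c\<in>A. \<forall>x\<in>coord c ` cdom c. bilinear (G c x)) \<and>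
     (\<forall>c\<in>A. \<forall>v w. smooth_on (coord c ` cdom c) (\<lambda>x. G c x v w)) \<and>
     (\<forall>c\<in>A. \<forall>c'\<in>A. \<forall>x\<in>coord c ` (cdom c \<inter> cdom c'). \<forall>v w.
        G c' (transition c c' x) (dtrans c c' x v) (dtrans c c' x w) =
        dtrans c c' x (G c x v w)
          - frechet_derivative (\<lambda>y. dtrans c c' y w) (at x) v)"

definition torsion_free :: "('a, 'd::finite) chart set \<Rightarrow> ('a, 'd) connection \<Rightarrow> bool" where
  "torsion_free A G \<longleftrightarrow>
     (\<forall>c\<in>A. \<forall>x\<in>coord c ` cdom c. \<forall>u v. torsion_tensor (G c) x u v = 0)"

definition zero_curvature :: "('a, 'd::finite) chart set \<Rightarrow> ('a, 'd) connection \<Rightarrow> bool" where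
  "zero_curvature A G \<longleftrightarrow>
     (\<forall>c\<in>A. \<forall>x\<in>coord c ` cdom c. \<forall>u v w. riemann (G c) x u v w = 0)"

definition nowhere_zero_curvature ::
  "('a, 'd::finite) chart set \<Rightarrow> ('a, 'd) connection \<Rightarrow> bool" where
  "nowhere_zero_curvature A G \<longleftrightarrow>
     (\<forall>c\<in>A. \<forall>x\<in>coord c ` cdom c. \<exists>u v w. riemann (G c) x u v w \<noteq> 0)"

subsection \<open>Affine manifolds\<close>

definition affine_manifold ::
  "'a topology \<Rightarrow> ('a, 'd::finite) chart set \<Rightarrow> ('a, 'd) connection \<Rightarrow> bool" where
  "affine_manifold X A D \<longleftrightarrow> smooth_manifold X A \<and> is_connection A D \<and>
     torsion_free A D \<and> zero_curvature A D"

text \<open>In an affine chart the connection is the canonical one of the Euclidean space, i.e. its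
  Christoffel symbols vanish.\<close>
definition affine_chart ::
  "('a, 'd::finite) chart set \<Rightarrow> ('a, 'd) connection \<Rightarrow> ('a, 'd) chart \<Rightarrow> bool" where
  "affine_chart A D c \<longleftrightarrow> c \<in> A \<and> (\<forall>x\<in>coord c ` cdom c. \<forall>v w. D c x v w = 0)"

text \<open>The Hessian, as a tensor, must be given in all charts and not only in the affine ones.
  In an affine chart its matrix is the matrix of second partial derivatives
  (\<open>hessian_affine_chart\<close> below); the expression in the other charts is the one
  which is forced by the transformation rule of tensors (\<open>hessian_transition\<close> below).\<close>
definition hessian ::
  "('a, 'd::finite) connection \<Rightarrow> ('a \<Rightarrow> real) \<Rightarrow> ('a, 'd) tensor2" where
  "hessian D f = (\<lambda>c x v w.
     frechet_derivative (\<lambda>y. differential f c y w) (at x) v - differential f c x (D c x v w))"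

lemma linear_differential_at:
  assumes "(\<lambda>y. f (pt c y)) differentiable (at x)"
  shows "linear (differential f c x)"
  using linear_frechet_derivative[OF assms] by (simp add: differential_def[abs_def])

lemma hessian_affine_chart:
  assumes "affine_chart A D c" "x \<in> coord c ` cdom c" "(\<lambda>y. f (pt c y)) differentiable (at x)"
  shows "hessian D f c x (axis i 1) (axis j 1) =
    frechet_derivative (\<lambda>y. frechet_derivative (\<lambda>z. f (pt c z)) (at y) (axis j 1)) (at x) (axis i 1)"
proof -
  have "D c x (axis i 1) (axis j 1) = 0"
    using assms(1,2) unfolding affine_chart_def by blast
  then show ?thesis
    using linear_0[OF linear_differential_at[OF assms(3)]] by (simp add: hessian_def differential_def)
qed

lemma smooth_on_differentiable:
  assumes "smooth_on S f" "x \<in> S"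
  shows "f differentiable (at x)" "(\<lambda>y. frechet_derivative f (at y) v) differentiable (at x)"
proof -
  have "times_differentiable_on (Suc (Suc 0)) S f"
    using assms(1) unfolding smooth_on_def by blast
  then show "f differentiable (at x)" "(\<lambda>y. frechet_derivative f (at y) v) differentiable (at x)"
    using assms(2) by auto
qed

lemma frechet_derivative_sum_axis:
  fixes F :: "real^'d::finite \<Rightarrow> real"
  assumes "F differentiable (at z)"
  shows "frechet_derivative F (at z) u = (\<Sum>i\<in>UNIV. u $ i * frechet_derivative F (at z) (axis i 1))"
proof -
  have lin: "linear (frechet_derivative F (at z))"
    using assms by (rule linear_frechet_derivative)
  have "frechet_derivative F (at z) u = frechet_derivative F (at z) (\<Sum>i\<in>UNIV. (u $ i) *\<^sub>R axis i 1)"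
    using basis_expansion[of u] by (simp add: scalar_mult_eq_scaleR)
  also have "\<dots> = (\<Sum>i\<in>UNIV. u $ i * frechet_derivative F (at z) (axis i 1))"
    by (simp add: linear_sum[OF lin] linear_cmul[OF lin])
  finally show ?thesis .
qed

lemma second_derivative_compose:
  fixes F :: "real^'d::finite \<Rightarrow> real" and T :: "real^'d \<Rightarrow> real^'d"
  assumes S: "open S" "x \<in> S" "smooth_on S T"
    and S': "open S'" "T ` S \<subseteq> S'" "smooth_on S' F"
    and E: "\<And>y. y \<in> S \<Longrightarrow> E y = F (T y)"
  shows "frechet_derivative E (at x) v = frechet_derivative F (at (T x)) (frechet_derivative T (at x) v)"
    and "frechet_derivative (\<lambda>y. frechet_derivative E (at y) w) (at x) v =
      frechet_derivative (\<lambda>z. frechet_derivative F (at z) (frechet_derivative T (at x) w))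
        (at (T x)) (frechet_derivative T (at x) v) +
      frechet_derivative F (at (T x)) (frechet_derivative (\<lambda>y. frechet_derivative T (at y) w) (at x) v)"
proof -
  let ?DF = "\<lambda>z. frechet_derivative F (at z)" and ?DT = "\<lambda>y. frechet_derivative T (at y)"
  have first: "frechet_derivative E (at y) u = ?DF (T y) (?DT y u)" if y: "y \<in> S" for y u
  proof -
    have "(T has_derivative ?DT y) (at y)"
      using smooth_on_differentiable(1)[OF S(3) y] frechet_derivative_works by blast
    moreover have "(F has_derivative ?DF (T y)) (at (T y))"
      using smooth_on_differentiable(1)[OF S'(3), of "T y"] y S'(2) frechet_derivative_works by blast
    ultimately have "((\<lambda>y. F (T y)) has_derivative (\<lambda>u. ?DF (T y) (?DT y u))) (at y)"
      by (rule has_derivative_compose)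
    then have "(E has_derivative (\<lambda>u. ?DF (T y) (?DT y u))) (at y)"
      by (rule has_derivative_transform_within_open[OF _ S(1) y]) (simp add: E)
    from frechet_derivative_at[OF this] show ?thesis
      by (rule fun_cong[symmetric])
  qed
  show "frechet_derivative E (at x) v = ?DF (T x) (?DT x v)"
    by (rule first[OF S(2)])
  have Tx: "T x \<in> S'"
    using S S' by blast
  define P where "P = (\<lambda>i z. ?DF z (axis i 1))"
  define u where "u = (\<lambda>y. ?DT y w)"
  define u' where "u' = frechet_derivative u (at x)"
  have DF: "?DF z q = (\<Sum>i\<in>UNIV. q $ i * P i z)" if "z \<in> S'" for z q
    unfolding P_def by (rule frechet_derivative_sum_axis[OF smooth_on_differentiable(1)[OF S'(3) that]])
  have P: "(P i has_derivative frechet_derivative (P i) (at (T x))) (at (T x))" for i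
    using smooth_on_differentiable(2)[OF S'(3) Tx] frechet_derivative_works
    unfolding P_def by blast
  have T: "(T has_derivative ?DT x) (at x)"
    using smooth_on_differentiable(1)[OF S(3) S(2)] frechet_derivative_works by blast
  have u: "(u has_derivative u') (at x)"
    using smooth_on_differentiable(2)[OF S(3) S(2)] frechet_derivative_works
    unfolding u_def u'_def by blast
  have ui: "((\<lambda>y. u y $ i) has_derivative (\<lambda>q. u' q $ i)) (at x)" for i
    using u by (rule bounded_linear.has_derivative[OF bounded_linear_vec_nth])
  have "((\<lambda>y. \<Sum>i\<in>UNIV. u y $ i * P i (T y)) has_derivative
      (\<lambda>q. \<Sum>i\<in>UNIV. u x $ i * frechet_derivative (P i) (at (T x)) (?DT x q)
        + u' q $ i * P i (T x))) (at x)"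
    by (intro has_derivative_sum has_derivative_mult ui has_derivative_compose[OF T P])
  then have "((\<lambda>y. frechet_derivative E (at y) w) has_derivative
      (\<lambda>q. \<Sum>i\<in>UNIV. u x $ i * frechet_derivative (P i) (at (T x)) (?DT x q)
        + u' q $ i * P i (T x))) (at x)"
  proof (rule has_derivative_transform_within_open[OF _ S(1) S(2)])
    fix y assume y: "y \<in> S"
    then have "T y \<in> S'"
      using S'(2) by blast
    then show "(\<Sum>i\<in>UNIV. u y $ i * P i (T y)) = frechet_derivative E (at y) w"
      unfolding first[OF y] by (simp only: DF u_def)
  qed
  from fun_cong[OF frechet_derivative_at[OF this], of v]
  have 1: "frechet_derivative (\<lambda>y. frechet_derivative E (at y) w) (at x) v =
      (\<Sum>i\<in>UNIV. u x $ i * frechet_derivative (P i) (at (T x)) (?DT x v)) + ?DF (T x) (u' v)"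
    by (simp only: DF[OF Tx] sum.distrib)
  have "((\<lambda>z. \<Sum>i\<in>UNIV. u x $ i * P i z) has_derivative
      (\<lambda>q. \<Sum>i\<in>UNIV. u x $ i * frechet_derivative (P i) (at (T x)) q)) (at (T x))"
    by (intro has_derivative_sum has_derivative_mult_right P)
  then have "((\<lambda>z. ?DF z (u x)) has_derivative
      (\<lambda>q. \<Sum>i\<in>UNIV. u x $ i * frechet_derivative (P i) (at (T x)) q)) (at (T x))"
    by (rule has_derivative_transform_within_open[OF _ S'(1) Tx]) (simp add: DF)
  from fun_cong[OF frechet_derivative_at[OF this], of "?DT x v"]
  have "frechet_derivative (\<lambda>z. ?DF z (u x)) (at (T x)) (?DT x v) =
      (\<Sum>i\<in>UNIV. u x $ i * frechet_derivative (P i) (at (T x)) (?DT x v))"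
    by (rule sym)
  with 1 show "frechet_derivative (\<lambda>y. frechet_derivative E (at y) w) (at x) v =
      frechet_derivative (\<lambda>z. ?DF z (?DT x w)) (at (T x)) (?DT x v) +
      ?DF (T x) (frechet_derivative (\<lambda>y. ?DT y w) (at x) v)"
    by (simp add: u_def u'_def)
qed

lemma chart_inj_on:
  assumes "is_chart X c"
  shows "inj_on (coord c) (cdom c)"
proof -
  have "inj_on (coord c) (topspace (subtopology X (cdom c)))"
    using assms homeomorphic_imp_injective_map unfolding is_chart_def by blast
  moreover have "cdom c \<subseteq> topspace X"
    using assms openin_subset unfolding is_chart_def by blast
  ultimately show ?thesis
    by (simp add: Int_absorb1)
qed

lemma chart_open_image:
  fixes c :: "('a, 'd::finite) chart"
  assumes c: "is_chart X c" and S: "openin X S" "S \<subseteq> cdom c"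
  shows "open (coord c ` S)"
proof -
  have "open_map (subtopology X (cdom c)) (top_of_set (coord c ` cdom c)) (coord c)"
    using c homeomorphic_imp_open_map unfolding is_chart_def by blast
  moreover have "openin (subtopology X (cdom c)) S"
    unfolding openin_subtopology using S by blast
  ultimately have "openin (top_of_set (coord c ` cdom c)) (coord c ` S)"
    unfolding open_map_def by blast
  then show ?thesis
    using c openin_open_trans unfolding is_chart_def by blast
qed

lemma hessian_transition:
  fixes D :: "('a, 'd::finite) connection"
  assumes A: "smooth_manifold X A" "is_connection A D"
    and W: "openin X W" "smooth_fun_on A W f"
    and c: "c \<in> A" "c' \<in> A" and x: "x \<in> coord c ` (cdom c \<inter> cdom c' \<inter> W)"
  shows "hessian D f c x v w =
    hessian D f c' (transition c c' x) (dtrans c c' x v) (dtrans c c' x w)"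
proof -
  let ?T = "transition c c'"
  define S where "S = coord c ` (cdom c \<inter> cdom c' \<inter> W)"
  define S' where "S' = coord c' ` (cdom c' \<inter> W)"
  have ch: "is_chart X c" "is_chart X c'"
    using A c unfolding smooth_manifold_def by auto
  note inj = chart_inj_on[OF ch(1)] chart_inj_on[OF ch(2)]
  have op: "openin X (cdom c)" "openin X (cdom c')"
    using ch unfolding is_chart_def by auto
  have S: "open S" "open S'"
    unfolding S_def S'_def using op W(1)
    by (auto intro!: chart_open_image[OF ch(1)] chart_open_image[OF ch(2)])
  have pt: "pt c (coord c p) = p" if "p \<in> cdom c" for p
    using that inj by (simp add: pt_def)
  have pt': "pt c' (coord c' p) = p" if "p \<in> cdom c'" for p
    using that inj by (simp add: pt_def)
  have T: "?T ` S \<subseteq> S'" "\<And>y. y \<in> S \<Longrightarrow> f (pt c y) = f (pt c' (?T y))"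
    unfolding S_def S'_def transition_def by (auto simp: pt pt')
  have sub: "smooth_on S g" if "smooth_on R g" "S \<subseteq> R" for R and g :: "real^'d \<Rightarrow> real^'d"
  proof -
    have "times_differentiable_on n R g \<Longrightarrow> times_differentiable_on n S g" for n and g :: "real^'d \<Rightarrow> real^'d"
    proof (induction n arbitrary: g)
      case 0
      then show ?case
        using continuous_on_subset that(2) by (metis times_differentiable_on.simps(1))
    next
      case (Suc n)
      then show ?case
        using that(2) unfolding times_differentiable_on.simps by blast
    qed
    then show ?thesis
      using that(1) unfolding smooth_on_def by blast
  qed
  have sT: "smooth_on S ?T"
    using A(1) c unfolding smooth_manifold_def compatible_def
    by (intro sub[of "coord c ` (cdom c \<inter> cdom c')"]) (auto simp: S_def)
  have sF: "smooth_on S' (\<lambda>z. f (pt c' z))"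
    using W(2) c unfolding smooth_fun_on_def S'_def by blast
  have xS: "x \<in> S"
    using x by (simp add: S_def)
  note comp = second_derivative_compose[OF S(1) xS sT S(2) T(1) sF, of "\<lambda>y. f (pt c y)", OF T(2)]
  have law: "D c' (?T x) (dtrans c c' x v) (dtrans c c' x w) =
      dtrans c c' x (D c x v w) - frechet_derivative (\<lambda>y. dtrans c c' y w) (at x) v"
    using A(2) c x unfolding is_connection_def by blast
  have lin: "linear (frechet_derivative (\<lambda>z. f (pt c' z)) (at (?T x)))"
    using smooth_on_differentiable(1)[OF sF] T(1) xS by (intro linear_frechet_derivative) blast
  show ?thesis
    unfolding hessian_def differential_def law linear_diff[OF lin]
    by (simp add: comp)
qed

definition hessian_manifold ::
  "'a topology \<Rightarrow> ('a, 'd::finite) chart set \<Rightarrow> ('a, 'd) connection \<Rightarrow> ('a, 'd) tensor2 \<Rightarrow> bool" where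
  "hessian_manifold X A D g \<longleftrightarrow>
     affine_manifold X A D \<and> connected_space X \<and> CARD('d) \<ge> 2 \<and>
     metric_on A (topspace X) g \<and>
     (\<forall>p\<in>topspace X. \<exists>W f. openin X W \<and> p \<in> W \<and> smooth_fun_on A W f \<and>
        eq_tensor2_on A W g (hessian D f))"

text \<open>Connectedness of the chart domain is needed: on a disconnected domain an affine chart is only
  determined up to a different affine map on each component.\<close>
definition pseudo_euclidean_manifold ::
  "'a topology \<Rightarrow> ('a, 'd::finite) chart set \<Rightarrow> ('a, 'd) connection \<Rightarrow> ('a, 'd) tensor2 \<Rightarrow> bool" where
  "pseudo_euclidean_manifold X A D g \<longleftrightarrow> hessian_manifold X A D g \<and>
     (\<forall>c. affine_chart A D c \<and> connected (coord c ` cdom c) \<longrightarrow>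
        (\<forall>x\<in>coord c ` cdom c. \<forall>y\<in>coord c ` cdom c. g c x = g c y))"


section \<open>Curves, geodesics and parallel transport\<close>

definition open_interval :: "real set \<Rightarrow> bool" where
  "open_interval I \<longleftrightarrow> open I \<and> is_interval I \<and> I \<noteq> {}"

definition smooth_curve ::
  "'a topology \<Rightarrow> ('a, 'd::finite) chart set \<Rightarrow> real set \<Rightarrow> (real \<Rightarrow> 'a) \<Rightarrow> bool" where
  "smooth_curve X A I \<gamma> \<longleftrightarrow> open_interval I \<and> continuous_map (top_of_set I) X \<gamma> \<and>
     (\<forall>c\<in>A. smooth_on {t\<in>I. \<gamma> t \<in> cdom c} (\<lambda>t. coord c (\<gamma> t)))"

definition velocity :: "('a, 'd::finite) chart \<Rightarrow> (real \<Rightarrow> 'a) \<Rightarrow> real \<Rightarrow> real^'d" where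
  "velocity c \<gamma> t = vector_derivative (\<lambda>s. coord c (\<gamma> s)) (at t)"

definition geodesic ::
  "'a topology \<Rightarrow> ('a, 'd::finite) chart set \<Rightarrow> ('a, 'd) connection \<Rightarrow> real set \<Rightarrow> (real \<Rightarrow> 'a) \<Rightarrow> bool"
  where
  "geodesic X A G I \<gamma> \<longleftrightarrow> smooth_curve X A I \<gamma> \<and>
     (\<forall>c\<in>A. \<forall>t\<in>I. \<gamma> t \<in> cdom c \<longrightarrow>
        vector_derivative (velocity c \<gamma>) (at t)
          + G c (coord c (\<gamma> t)) (velocity c \<gamma> t) (velocity c \<gamma> t) = 0)"

text \<open>A curve which is a geodesic after a change of parameter.\<close>
definition unparameterized_geodesic ::
  "'a topology \<Rightarrow> ('a, 'd::finite) chart set \<Rightarrow> ('a, 'd) connection \<Rightarrow> real set \<Rightarrow> (real \<Rightarrow> 'a) \<Rightarrow> bool"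
  where
  "unparameterized_geodesic X A G I \<gamma> \<longleftrightarrow> smooth_curve X A I \<gamma> \<and>
     (\<exists>J \<tau>. open_interval J \<and> bij_betw \<tau> J I \<and> smooth_on J \<tau> \<and>
        (\<forall>t\<in>J. vector_derivative \<tau> (at t) \<noteq> 0) \<and> geodesic X A G J (\<gamma> \<circ> \<tau>))"

definition same_unparameterized_geodesics ::
  "'a topology \<Rightarrow> ('a, 'd::finite) chart set \<Rightarrow> ('a, 'd) connection \<Rightarrow> ('a, 'd) connection \<Rightarrow> bool"
  where
  "same_unparameterized_geodesics X A G G' \<longleftrightarrow>
     (\<forall>I \<gamma>. unparameterized_geodesic X A G I \<gamma> \<longleftrightarrow> unparameterized_geodesic X A G' I \<gamma>)"

text \<open>\<open>V c t\<close> are the components in the chart \<open>c\<close> of a tangent vector at \<open>\<gamma> t\<close>.\<close>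
definition parallel_field ::
  "('a, 'd::finite) chart set \<Rightarrow> ('a, 'd) connection \<Rightarrow> real set \<Rightarrow> (real \<Rightarrow> 'a) \<Rightarrow>
     (('a, 'd) chart \<Rightarrow> real \<Rightarrow> real^'d) \<Rightarrow> bool" where
  "parallel_field A G I \<gamma> V \<longleftrightarrow>
     (\<forall>c\<in>A. \<forall>c'\<in>A. \<forall>t\<in>I. \<gamma> t \<in> cdom c \<inter> cdom c' \<longrightarrow>
        V c' t = dtrans c c' (coord c (\<gamma> t)) (V c t)) \<and>
     (\<forall>c\<in>A. \<forall>t\<in>I. \<gamma> t \<in> cdom c \<longrightarrow>
        (V c has_vector_derivative - G c (coord c (\<gamma> t)) (velocity c \<gamma> t) (V c t)) (at t))"

subsection \<open>Volume forms\<close>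

text \<open>A form of maximal degree is given in each chart \<open>c\<close> by its coefficient \<open>\<omega> c x\<close>
  with respect to the form \<open>dx\<^sub>1 \<and> \<dots> \<and> dx\<^sub>d\<close> of this chart.\<close>
type_synonym ('a, 'd) volform = "('a, 'd) chart \<Rightarrow> real^'d \<Rightarrow> real"

definition volume_form_on ::
  "('a, 'd::finite) chart set \<Rightarrow> 'a set \<Rightarrow> ('a, 'd) volform \<Rightarrow> bool" where
  "volume_form_on A W \<omega> \<longleftrightarrow>
     (\<forall>c\<in>A. smooth_on (coord c ` (cdom c \<inter> W)) (\<omega> c)) \<and>
     (\<forall>c\<in>A. \<forall>x\<in>coord c ` (cdom c \<inter> W). \<omega> c x \<noteq> 0) \<and>
     (\<forall>c\<in>A. \<forall>c'\<in>A. \<forall>x\<in>coord c ` (cdom c \<inter> cdom c' \<inter> W).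
        \<omega> c x = det (matrix (dtrans c c' x)) * \<omega> c' (transition c c' x))"

text \<open>Value of the form on \<open>d\<close> tangent vectors.\<close>
definition volform_apply ::
  "('a, 'd::finite) volform \<Rightarrow> ('a, 'd) chart \<Rightarrow> real^'d \<Rightarrow> ('d \<Rightarrow> real^'d) \<Rightarrow> real" where
  "volform_apply \<omega> c x v = \<omega> c x * det (\<chi> i. v i)"

definition preserves_volume_form ::
  "'a topology \<Rightarrow> ('a, 'd::finite) chart set \<Rightarrow> ('a, 'd) connection \<Rightarrow> 'a set \<Rightarrow> ('a, 'd) volform \<Rightarrow> bool"
  where
  "preserves_volume_form X A G W \<omega> \<longleftrightarrow>
     (\<forall>I \<gamma> V. smooth_curve X A I \<gamma> \<and> \<gamma> ` I \<subseteq> W \<and> (\<forall>i. parallel_field A G I \<gamma> (V i)) \<longrightarrow>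
        (\<exists>k. \<forall>t\<in>I. \<forall>c\<in>A. \<gamma> t \<in> cdom c \<longrightarrow>
           volform_apply \<omega> c (coord c (\<gamma> t)) (\<lambda>i. V i c t) = k))"

definition incompressible ::
  "'a topology \<Rightarrow> ('a, 'd::finite) chart set \<Rightarrow> ('a, 'd) connection \<Rightarrow> bool" where
  "incompressible X A G \<longleftrightarrow>
     (\<forall>p\<in>topspace X. \<exists>W \<omega>. openin X W \<and> p \<in> W \<and> volume_form_on A W \<omega> \<and>
        preserves_volume_form X A G W \<omega>)"

text \<open>The form \<open>dx\<^sub>1 \<and> \<dots> \<and> dx\<^sub>d\<close> of the chart \<open>a\<close>, defined on the domain of \<open>a\<close>.\<close>
definition chart_volume :: "('a, 'd::finite) chart \<Rightarrow> ('a, 'd) volform" where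
  "chart_volume a = (\<lambda>c x. det (matrix (dtrans c a x)))"

subsection \<open>Holonomy around small rectangles\<close>

text \<open>Parallel transport of the vector \<open>v\<close> along the segment from \<open>x\<close> to \<open>x + s\<close>.\<close>
definition segment_transport ::
  "'d::finite christoffel \<Rightarrow> real^'d \<Rightarrow> real^'d \<Rightarrow> real^'d \<Rightarrow> real^'d" where
  "segment_transport G x s v = (THE v'. \<exists>V. V 0 = v \<and> V 1 = v' \<and>
     (\<forall>t\<in>{0..1}. (V has_vector_derivative - G (x + t *\<^sub>R s) s (V t)) (at t within {0..1})))"

definition rectangle_holonomy ::
  "'d::finite christoffel \<Rightarrow> real^'d \<Rightarrow> real^'d \<Rightarrow> real^'d \<Rightarrow> real^'d \<Rightarrow> real^'d" where
  "rectangle_holonomy G x r s =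
     segment_transport G (x + s) (- s) \<circ> segment_transport G (x + r + s) (- r) \<circ>
     segment_transport G (x + r) s \<circ> segment_transport G x r"

definition infinitesimal_similarity ::
  "(real^'d::finite \<Rightarrow> real^'d \<Rightarrow> real) \<Rightarrow> (real^'d \<Rightarrow> real^'d) \<Rightarrow> bool" where
  "infinitesimal_similarity h M \<longleftrightarrow> linear M \<and>
     (\<exists>k::real. \<forall>v w. h (M v) w + h v (M w) = k * h v w)"

text \<open>The rectangle has a vertex at \<open>x\<close>, its sides have the directions of the orthonormal vectors
  \<open>e\<close> and \<open>e'\<close>, and the lengths \<open>a\<close> and \<open>b\<close>, which tend to 0; its area is \<open>a * b\<close>.\<close>
definition infinitesimally_conformal ::
  "('a, 'd::finite) chart set \<Rightarrow> ('a, 'd) connection \<Rightarrow> ('a, 'd) tensor2 \<Rightarrow> ('a, 'd) connection \<Rightarrow> bool"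
  where
  "infinitesimally_conformal A D g G \<longleftrightarrow>
     (\<forall>c x e e'. affine_chart A D c \<and> x \<in> coord c ` cdom c \<and>
        norm e = 1 \<and> norm e' = 1 \<and> e \<bullet> e' = 0 \<longrightarrow>
        (\<exists>M. infinitesimal_similarity (g c x) M \<and>
           (\<forall>v. ((\<lambda>(a, b). (rectangle_holonomy (G c) x (a *\<^sub>R e) (b *\<^sub>R e') v
                               - v - (a * b) *\<^sub>R M v) /\<^sub>R (a * b))
                 \<longlongrightarrow> 0) (at_right 0 \<times>\<^sub>F at_right 0))))"


section \<open>Hybrid connections\<close>

definition hybrid_connection ::
  "'a topology \<Rightarrow> ('a, 'd::finite) chart set \<Rightarrow> ('a, 'd) connection \<Rightarrow> ('a, 'd) tensor2 \<Rightarrow>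
     ('a, 'd) connection \<Rightarrow> bool" where
  "hybrid_connection X A D g G \<longleftrightarrow>
     is_connection A G \<and> torsion_free A G \<and>
     same_unparameterized_geodesics X A G D \<and>
     incompressible X A G \<and>
     infinitesimally_conformal A D g G \<and>
     nowhere_zero_curvature A G"

text \<open>The properties which characterize the hybrid potential of the hybrid connection \<open>G\<close>.\<close>
definition hybrid_potential ::
  "'a topology \<Rightarrow> ('a, 'd::finite) chart set \<Rightarrow> ('a, 'd) connection \<Rightarrow> ('a, 'd) tensor2 \<Rightarrow>
     ('a, 'd) connection \<Rightarrow> ('a \<Rightarrow> real) \<Rightarrow> bool" where
  "hybrid_potential X A D g G \<psi> \<longleftrightarrow>
     (\<forall>p\<in>topspace X. \<psi> p \<noteq> 0) \<and> smooth_fun_on A (topspace X) \<psi> \<and>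
     eq_tensor2_on A (topspace X) (hessian D \<psi>) g \<and>
     (\<forall>c\<in>A. \<forall>S V. open S \<and> S \<subseteq> coord c ` cdom c \<and> smooth_on S V \<longrightarrow>
        (\<forall>x\<in>S. \<forall>u.
           covd (G c) (\<lambda>_. u) V x = covd (D c) (\<lambda>_. u) V x
             - (differential \<psi> c x u *\<^sub>R V x + differential \<psi> c x (V x) *\<^sub>R u) /\<^sub>R \<psi> (pt c x)))"

definition isochrone_metric :: "('a \<Rightarrow> real) \<Rightarrow> ('a, 'd::finite) tensor2 \<Rightarrow> ('a, 'd) tensor2" where
  "isochrone_metric \<psi> g = scale (\<lambda>p. 1 / \<psi> p ^ 4) g"

end

theory Submission
  imports Defs
begin

text \<open>In any chart the hybrid connection is \<open>D\<close> plus the projective change defined by the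
  closed form \<open>- d\<psi> / \<psi>\<close>, so the classical formula for projective changes gives
  \<open>R(u,v)w = (g(v,w) u - g(u,w) v) / \<psi>\<close>, whose trace is \<open>(d - 1) g / \<psi>\<close>. The symmetry of second
  derivatives which enters here is read off the symmetry of \<open>g = H(\<psi>)\<close>. Working in
  arbitrary charts avoids the existence of affine charts.\<close>

section \<open>Calculus of smooth functions\<close>

text \<open>Why the first derivatives of \<psi> leave the curvature: a projective change by a
  one-form \<theta> enters through \<open>D \<theta> - \<theta> \<theta>\<close>. For
  \<open>\<theta> = - d\<psi> / \<psi>\<close> the derivative of \<open>1 / \<psi>\<close> and the
  square of \<theta> give the same multiple of \<open>d\<psi> d\<psi>\<close>; they cancel, and only
  \<open>- H(\<psi>) / \<psi>\<close> remains. The volume claim is a separate computation, on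
  determinants of parallel frames. It quantifies over affine charts \<open>a\<close>, so it is
  carried out in the given \<open>a\<close>, where D drops out of the transport equation. The
  calculus below is the price of the word "metric": the rescaled tensors and the volume coefficients
  must be shown smooth, which includes |\<psi>| and Jacobian determinants. As
  \<open>smooth_on\<close> is defined by iterated directional derivatives, each closure property is
  an induction on the order.\<close>

lemma times_differentiable_on_SucD:
  "times_differentiable_on (Suc n) S f \<Longrightarrow> times_differentiable_on n S f"
proof (induction n arbitrary: f)
  case 0
  then show ?case
    by (auto intro!: continuous_at_imp_continuous_on differentiable_imp_continuous_within)
next
  case (Suc n)
  show ?case
    using Suc.prems Suc.IH[of "\<lambda>x. frechet_derivative f (at x) v" for v]
    unfolding times_differentiable_on.simps(2)[of "Suc n"] times_differentiable_on.simps(2)[of n S f]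
    by (meson times_differentiable_on.simps(2))
qed

text \<open>The derivative at a point depends only on the germ there. Coordinate expressions through
  \<open>pt c\<close> are meaningful only on the image of a chart, so identities between them hold
  on an open set and not globally.\<close>

lemma frechet_derivative_cong_open:
  assumes "open S" "x \<in> S" "\<And>y. y \<in> S \<Longrightarrow> f y = g y" "f differentiable (at x)"
  shows "g differentiable (at x)" "frechet_derivative g (at x) = frechet_derivative f (at x)"
proof -
  have "(f has_derivative frechet_derivative f (at x)) (at x)"
    using assms(4) frechet_derivative_works by blast
  then have g: "(g has_derivative frechet_derivative f (at x)) (at x)"
    by (rule has_derivative_transform_within_open[OF _ assms(1,2)]) (rule assms(3))
  then show "g differentiable (at x)"
    unfolding differentiable_def by blast
  show "frechet_derivative g (at x) = frechet_derivative f (at x)"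
    by (rule frechet_derivative_at[OF g, symmetric])
qed

lemma times_differentiable_on_cong:
  assumes "open S" "times_differentiable_on n S f" "\<And>x. x \<in> S \<Longrightarrow> f x = g x"
  shows "times_differentiable_on n S g"
  using assms(2,3)
proof (induction n arbitrary: f g)
  case 0
  then show ?case
    using continuous_on_cong[of S S f g] by simp
next
  case (Suc n)
  have g: "g differentiable (at x)" "frechet_derivative g (at x) = frechet_derivative f (at x)"
    if "x \<in> S" for x
  proof -
    have "f differentiable (at x)"
      using Suc.prems(1) that by simp
    from frechet_derivative_cong_open[OF assms(1) that Suc.prems(2) this]
    show "g differentiable (at x)" "frechet_derivative g (at x) = frechet_derivative f (at x)"
      by blast+
  qed
  have "times_differentiable_on n S (\<lambda>x. frechet_derivative g (at x) v)" for v
  proof (rule Suc.IH)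
    show "times_differentiable_on n S (\<lambda>x. frechet_derivative f (at x) v)"
      using Suc.prems(1) by simp
  qed (simp add: g)
  then show ?case
    using g(1) by simp
qed

lemma times_differentiable_on_subset:
  "times_differentiable_on n S f \<Longrightarrow> T \<subseteq> S \<Longrightarrow> times_differentiable_on n T f"
proof (induction n arbitrary: f)
  case 0
  then show ?case
    by (auto intro: continuous_on_subset)
next
  case (Suc n)
  show ?case
    using Suc.prems Suc.IH[of "\<lambda>x. frechet_derivative f (at x) v" for v] by auto
qed

text \<open>Induction step for the closure rules: an explicit derivative \<open>f'\<close>, as the
  differentiation rules produce it, may stand for \<open>frechet_derivative\<close> although the two
  are known to agree only on \<open>S\<close>.\<close>

lemma times_differentiable_on_Suc_has_derivative:
  assumes "open S" "\<And>x. x \<in> S \<Longrightarrow> (f has_derivative f' x) (at x)"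
    "\<And>v. times_differentiable_on n S (\<lambda>x. f' x v)"
  shows "times_differentiable_on (Suc n) S f"
proof -
  have "times_differentiable_on n S (\<lambda>x. frechet_derivative f (at x) v)" for v
    by (rule times_differentiable_on_cong[OF assms(1,3)])
      (simp add: frechet_derivative_at[OF assms(2), symmetric])
  then show ?thesis
    using assms(2) unfolding times_differentiable_on.simps differentiable_def by blast
qed

lemma times_differentiable_on_has_derivative:
  assumes "times_differentiable_on (Suc n) S f" "x \<in> S"
  shows "(f has_derivative frechet_derivative f (at x)) (at x)"
  using assms frechet_derivative_works by auto

lemma smooth_on_has_derivative:
  assumes "smooth_on S f" "x \<in> S"
  shows "(f has_derivative frechet_derivative f (at x)) (at x)"
    "((\<lambda>y. frechet_derivative f (at y) v) has_derivative
      frechet_derivative (\<lambda>y. frechet_derivative f (at y) v) (at x)) (at x)"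
  using smooth_on_differentiable[OF assms] frechet_derivative_works by blast+

lemma times_differentiable_on_const: "open S \<Longrightarrow> times_differentiable_on n S (\<lambda>_. c)"
proof (induction n arbitrary: c)
  case (Suc n)
  show ?case
    by (rule times_differentiable_on_Suc_has_derivative[OF Suc.prems, where f' = "\<lambda>_ _. 0"])
      (auto intro: Suc)
qed simp

lemma times_differentiable_on_add:
  assumes "open S" "times_differentiable_on n S f" "times_differentiable_on n S g"
  shows "times_differentiable_on n S (\<lambda>x. f x + g x)"
  using assms(2,3)
proof (induction n arbitrary: f g)
  case 0
  then show ?case by (auto intro: continuous_on_add)
next
  case (Suc n)
  show ?case
  proof (rule times_differentiable_on_Suc_has_derivative[OF assms(1)])
    show "((\<lambda>x. f x + g x) has_derivative
        (\<lambda>v. frechet_derivative f (at x) v + frechet_derivative g (at x) v)) (at x)"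
      if "x \<in> S" for x
      using Suc.prems[THEN times_differentiable_on_has_derivative] that
      by (intro has_derivative_add)
  qed (use Suc in auto)
qed

lemma times_differentiable_on_mult:
  fixes f g :: "'a::real_normed_vector \<Rightarrow> real"
  assumes "open S" "times_differentiable_on n S f" "times_differentiable_on n S g"
  shows "times_differentiable_on n S (\<lambda>x. f x * g x)"
  using assms(2,3)
proof (induction n arbitrary: f g)
  case 0
  then show ?case by (auto intro: continuous_on_mult)
next
  case (Suc n)
  show ?case
  proof (rule times_differentiable_on_Suc_has_derivative[OF assms(1)])
    show "((\<lambda>x. f x * g x) has_derivative
        (\<lambda>v. f x * frechet_derivative g (at x) v + frechet_derivative f (at x) v * g x)) (at x)"
      if "x \<in> S" for x
      using Suc.prems[THEN times_differentiable_on_has_derivative] that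
      by (intro has_derivative_mult)
    \<comment> \<open>The product rule keeps an undifferentiated factor in each summand; lowering
      its order from \<open>Suc n\<close> to \<open>n\<close> makes the induction hypothesis
      applicable.\<close>
    show "times_differentiable_on n S
        (\<lambda>x. f x * frechet_derivative g (at x) v + frechet_derivative f (at x) v * g x)" for v
      using Suc.prems Suc.prems[THEN times_differentiable_on_SucD]
      by (intro times_differentiable_on_add[OF assms(1)] Suc.IH) simp_all
  qed
qed

lemma times_differentiable_on_inverse:
  fixes f :: "'a::real_normed_vector \<Rightarrow> real"
  assumes "open S" "times_differentiable_on n S f" "\<And>x. x \<in> S \<Longrightarrow> f x \<noteq> 0"
  shows "times_differentiable_on n S (\<lambda>x. inverse (f x))"
  using assms(2)
proof (induction n)
  case 0
  then show ?case using assms(3) by (auto intro: continuous_on_inverse)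
next
  case (Suc n)
  have IH: "times_differentiable_on n S (\<lambda>x. inverse (f x))"
    using Suc times_differentiable_on_SucD by blast
  show ?case
  proof (rule times_differentiable_on_Suc_has_derivative[OF assms(1)])
    \<comment> \<open>The sign is written as a factor \<open>- 1\<close>, so that the derivative is
      a product of functions already known to be \<open>n\<close> times differentiable, among them
      the inverse itself.\<close>
    show "((\<lambda>x. inverse (f x)) has_derivative
        (\<lambda>v. (- 1) * (inverse (f x) * frechet_derivative f (at x) v * inverse (f x)))) (at x)"
      if "x \<in> S" for x
      using Deriv.has_derivative_inverse[OF assms(3)[OF that]
          times_differentiable_on_has_derivative[OF Suc.prems that]] by simp
  qed (intro times_differentiable_on_mult times_differentiable_on_const assms(1) IH;
      use Suc.prems in simp)
qed

text \<open>Away from the zeros of \<open>f\<close> the function \<open>sgn (f x)\<close> is locally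
  constant, and |f| is its product with \<open>f\<close>. This serves the factor 1 /
  |\<psi>|.\<close>

lemma times_differentiable_on_abs:
  fixes f :: "'a::real_normed_vector \<Rightarrow> real"
  assumes "open S" "times_differentiable_on n S f" "\<And>x. x \<in> S \<Longrightarrow> f x \<noteq> 0"
  shows "times_differentiable_on n S (\<lambda>x. \<bar>f x\<bar>)"
proof (cases n)
  case 0
  then show ?thesis using assms(2) by (auto intro: continuous_on_rabs)
next
  case (Suc m)
  have sgn: "((\<lambda>x. sgn (f x)) has_derivative (\<lambda>_. 0)) (at x)" if "x \<in> S" for x
  proof -
    have f: "continuous_on S f"
      using assms(2) unfolding Suc
      by (auto intro!: continuous_at_imp_continuous_on differentiable_imp_continuous_within)
    \<comment> \<open>A positive product singles out the points of \<open>S\<close> at which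
      \<open>f\<close> has the same sign as at \<open>x\<close>.\<close>
    define U where "U = {y \<in> S. f y * f x > 0}"
    have U: "U = S \<inter> (\<lambda>y. f y * f x) -` {0<..}"
      unfolding U_def by auto
    have "open U"
      unfolding U
      by (intro continuous_open_preimage[OF _ assms(1) open_greaterThan] continuous_on_mult_right f)
    moreover have "x \<in> U"
      using assms(3)[OF that] that by (auto simp: U_def zero_less_mult_iff)
    moreover have "sgn (f x) = sgn (f y)" if "y \<in> U" for y
      using that by (auto simp: U_def zero_less_mult_iff)
    ultimately show ?thesis
      by (rule has_derivative_transform_within_open[OF has_derivative_const])
  qed
  have "times_differentiable_on n S (\<lambda>x. sgn (f x))"
    unfolding Suc
    by (rule times_differentiable_on_Suc_has_derivative[OF assms(1) sgn])
      (auto intro: times_differentiable_on_const assms(1))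
  from times_differentiable_on_mult[OF assms(1) this assms(2)] show ?thesis
    by (simp add: abs_sgn mult.commute)
qed

lemma times_differentiable_on_sum:
  assumes "open S" "finite I" "\<And>i. i \<in> I \<Longrightarrow> times_differentiable_on n S (f i)"
  shows "times_differentiable_on n S (\<lambda>x. \<Sum>i\<in>I. f i x)"
  using assms(2,3)
  by (induction I) (simp_all add: times_differentiable_on_const times_differentiable_on_add assms(1))

lemma times_differentiable_on_prod:
  fixes f :: "'i \<Rightarrow> 'a::real_normed_vector \<Rightarrow> real"
  assumes "open S" "finite I" "\<And>i. i \<in> I \<Longrightarrow> times_differentiable_on n S (f i)"
  shows "times_differentiable_on n S (\<lambda>x. \<Prod>i\<in>I. f i x)"
  using assms(2,3)
  by (induction I) (simp_all add: times_differentiable_on_const times_differentiable_on_mult assms(1))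

lemma times_differentiable_on_power:
  fixes f :: "'a::real_normed_vector \<Rightarrow> real"
  assumes "open S" "times_differentiable_on n S f"
  shows "times_differentiable_on n S (\<lambda>x. f x ^ k)"
  using times_differentiable_on_prod[OF assms(1), of "{..<k}" n "\<lambda>_. f"] assms(2) by simp

lemma times_differentiable_on_nth:
  assumes "open S" "times_differentiable_on n S f"
  shows "times_differentiable_on n S (\<lambda>x. f x $ i)"
  using assms(2)
proof (induction n arbitrary: f)
  case 0
  then show ?case by (auto intro: continuous_on_component)
next
  case (Suc n)
  show ?case
  proof (rule times_differentiable_on_Suc_has_derivative[OF assms(1)])
    show "((\<lambda>x. f x $ i) has_derivative (\<lambda>v. frechet_derivative f (at x) v $ i)) (at x)"
      if "x \<in> S" for x
      by (rule bounded_linear.has_derivative[OF bounded_linear_vec_nth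
          times_differentiable_on_has_derivative[OF Suc.prems that]])
  qed (use Suc in auto)
qed

lemma times_differentiable_on_det:
  fixes f :: "'a::real_normed_vector \<Rightarrow> real^'d::finite^'d"
  assumes "open S" "\<And>i j. times_differentiable_on n S (\<lambda>x. f x $ i $ j)"
  shows "times_differentiable_on n S (\<lambda>x. det (f x))"
  unfolding det_def
  by (intro times_differentiable_on_sum times_differentiable_on_mult times_differentiable_on_prod
      times_differentiable_on_const assms finite_permutations finite)

lemma smooth_on_subset: "smooth_on S f \<Longrightarrow> T \<subseteq> S \<Longrightarrow> smooth_on T f"
  unfolding smooth_on_def using times_differentiable_on_subset by blast

lemma smooth_on_mult:
  fixes f g :: "'a::real_normed_vector \<Rightarrow> real"
  shows "open S \<Longrightarrow> smooth_on S f \<Longrightarrow> smooth_on S g \<Longrightarrow> smooth_on S (\<lambda>x. f x * g x)"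
  unfolding smooth_on_def by (simp add: times_differentiable_on_mult)

lemma smooth_on_divide:
  fixes f g :: "'a::real_normed_vector \<Rightarrow> real"
  assumes "open S" "smooth_on S f" "smooth_on S g" "\<And>x. x \<in> S \<Longrightarrow> g x \<noteq> 0"
  shows "smooth_on S (\<lambda>x. f x / g x)"
  using assms unfolding smooth_on_def divide_inverse
  by (simp add: times_differentiable_on_mult times_differentiable_on_inverse)

lemma smooth_on_const: "open S \<Longrightarrow> smooth_on S (\<lambda>_. c)"
  unfolding smooth_on_def by (simp add: times_differentiable_on_const)

lemma smooth_on_power:
  fixes f :: "'a::real_normed_vector \<Rightarrow> real"
  shows "open S \<Longrightarrow> smooth_on S f \<Longrightarrow> smooth_on S (\<lambda>x. f x ^ k)"
  unfolding smooth_on_def by (simp add: times_differentiable_on_power)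

lemma smooth_on_abs:
  fixes f :: "'a::real_normed_vector \<Rightarrow> real"
  shows "open S \<Longrightarrow> smooth_on S f \<Longrightarrow> (\<And>x. x \<in> S \<Longrightarrow> f x \<noteq> 0) \<Longrightarrow> smooth_on S (\<lambda>x. \<bar>f x\<bar>)"
  unfolding smooth_on_def by (simp add: times_differentiable_on_abs)

lemma smooth_on_det_derivative:
  fixes f :: "real^'d::finite \<Rightarrow> real^'d"
  assumes "open S" "smooth_on S f"
  shows "smooth_on S (\<lambda>x. det (matrix (frechet_derivative f (at x))))"
proof -
  have "times_differentiable_on n S (\<lambda>x. frechet_derivative f (at x) v)" for n v
    using assms(2) unfolding smooth_on_def by (metis times_differentiable_on.simps(2))
  then have "times_differentiable_on n S (\<lambda>x. frechet_derivative f (at x) (axis j 1) $ i)" for n i j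
    by (rule times_differentiable_on_nth[OF assms(1)])
  then show ?thesis
    unfolding smooth_on_def
    by (intro allI times_differentiable_on_det[OF assms(1)]) (simp add: matrix_def)
qed

section \<open>Derivatives of determinants\<close>

text \<open>Product rule in every summand of the Leibniz expansion; interchanging the two sums
  collects the terms by the row that is differentiated.\<close>

lemma has_real_derivative_det:
  fixes V :: "real \<Rightarrow> real^'d::finite^'d"
  assumes "\<And>i. ((\<lambda>t. V t $ i) has_vector_derivative V' i) (at t)"
  shows "((\<lambda>t. det (V t)) has_real_derivative
    (\<Sum>i\<in>UNIV. det (\<chi> k. if k = i then V' i else V t $ k))) (at t)"
proof -
  have e: "((\<lambda>t. V t $ i $ j) has_real_derivative V' i $ j) (at t)" for i j
    using bounded_linear.has_vector_derivative[OF bounded_linear_vec_nth assms]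
    unfolding has_real_derivative_iff_has_vector_derivative .
  have p: "(\<Prod>k\<in>UNIV. (\<chi> k. if k = i then V' i else V t $ k) $ k $ p k) =
      V' i $ p i * (\<Prod>k\<in>UNIV - {i}. V t $ k $ p k)" for i and p :: "'d \<Rightarrow> 'd"
    by (subst prod.remove[of _ i]) (auto intro!: prod.cong)
  have "((\<lambda>t. det (V t)) has_real_derivative
      (\<Sum>p\<in>{p. p permutes UNIV}. of_int (sign p) *
        (\<Sum>i\<in>UNIV. V' i $ p i * (\<Prod>k\<in>UNIV - {i}. V t $ k $ p k)))) (at t)"
    unfolding det_def
    by (intro DERIV_sum DERIV_cmult has_field_derivative_prod e)
  also have "(\<Sum>p\<in>{p. p permutes UNIV}. of_int (sign p) *
        (\<Sum>i\<in>UNIV. V' i $ p i * (\<Prod>k\<in>UNIV - {i}. V t $ k $ p k))) =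
      (\<Sum>i\<in>UNIV. det (\<chi> k. if k = i then V' i else V t $ k))"
    unfolding det_def p sum_distrib_left by (rule sum.swap)
  finally show ?thesis .
qed

text \<open>Cramer's lemma, applied to the expansion of \<open>M $ i\<close> in the standard basis,
  leaves only the diagonal entry. The sum is the derivative of \<open>det\<close> at the identity in
  the direction \<open>M\<close>.\<close>

lemma sum_det_replace_row_mat_1:
  fixes M :: "real^'d::finite^'d"
  shows "(\<Sum>i\<in>UNIV. det (\<chi> k. if k = i then M $ i else mat 1 $ k)) = trace M"
proof -
  have m: "(mat 1 :: real^'d^'d) $ k = axis k 1" for k
    by (simp add: mat_def axis_def vec_eq_iff)
  then have r: "row k (mat 1 :: real^'d^'d) = axis k 1" for k
    by (simp add: row_def)
  have "det (\<chi> k. if k = i then M $ i else (mat 1 :: real^'d^'d) $ k) = M $ i $ i" for i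
    using cramer_lemma_transpose[of i "M $ i" "mat 1 :: real^'d^'d"]
    unfolding r m basis_expansion by simp
  then show ?thesis
    by (simp add: trace_def)
qed

text \<open>Both sides are the derivative at 0 of \<open>det (V (1 + s M)) = det V det (1 + s M)\<close>; in contrast
  to Cramer's rule this does not require \<open>V\<close> to be invertible.\<close>
lemma sum_det_replace_row_mult:
  fixes V M :: "real^'d::finite^'d"
  shows "(\<Sum>i\<in>UNIV. det (\<chi> k. if k = i then (V ** M) $ i else V $ k)) = trace M * det V"
proof -
  have d: "((\<lambda>s. (B + s *\<^sub>R C) $ i) has_vector_derivative C $ i) (at (0::real))"
    for B C :: "real^'d^'d" and i
    by (auto intro!: derivative_eq_intros simp: has_vector_derivative_def)
  have "det (V + s *\<^sub>R (V ** M)) = det V * det (mat 1 + s *\<^sub>R M)" for s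
  proof -
    have "V + s *\<^sub>R (V ** M) = V ** (mat 1 + s *\<^sub>R M)"
      by (simp add: matrix_add_ldistrib scalar_matrix_assoc[symmetric] matrix_scalar_ac)
    then show ?thesis by (simp add: det_mul)
  qed
  then have "((\<lambda>s. det (V + s *\<^sub>R (V ** M))) has_real_derivative det V * trace M) (at 0)"
    using DERIV_cmult[OF has_real_derivative_det[OF d, of "mat 1" M], of "det V"]
    by (simp add: sum_det_replace_row_mat_1 cong: if_cong)
  from DERIV_unique[OF has_real_derivative_det[OF d, of V "V ** M"] this] show ?thesis
    by (simp add: mult.commute cong: if_cong)
qed

section \<open>Curvature of projectively equivalent connections\<close>

lemma torsion_tensor_eq: "torsion_tensor G x u v = G x u v - G x v u"
  by (simp add: torsion_tensor_def torsion_def covd_def lie_bracket_def)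

text \<open>Constant fields have zero bracket and zero derivative; bilinearity is what kills the
  term along the bracket.\<close>

lemma riemann_eq:
  assumes "bilinear (G x)"
  shows "riemann G x u v w =
    frechet_derivative (\<lambda>y. G y v w) (at x) u - frechet_derivative (\<lambda>y. G y u w) (at x) v
      + G x u (G x v w) - G x v (G x u w)"
  by (simp add: riemann_def curvature_def covd_def[abs_def] lie_bracket_def bilinear_lzero[OF assms])

lemma riemann_projective_change:
  fixes p :: "real^'d::finite \<Rightarrow> real" and D G :: "'d christoffel" and x :: "real^'d"
  defines "q \<equiv> \<lambda>y. frechet_derivative p (at y)"
  defines "H \<equiv> \<lambda>u v. frechet_derivative (\<lambda>y. q y v) (at x) u - q x (D x u v)"
  assumes S: "open S" "x \<in> S" and p: "smooth_on S p" "p x \<noteq> 0"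
    and D: "bilinear (D x)" "\<And>u v. D x u v = D x v u" "\<And>u v. smooth_on S (\<lambda>y. D y u v)"
    and G: "bilinear (G x)"
      "\<And>y u v. y \<in> S \<Longrightarrow> G y u v = D y u v - (q y u *\<^sub>R v + q y v *\<^sub>R u) /\<^sub>R p y"
    and H: "\<And>u v. H u v = H v u"
  shows "riemann G x u v w = riemann D x u v w + (H v w *\<^sub>R u - H u w *\<^sub>R v) /\<^sub>R p x"
proof -
  define P where "P = inverse (p x)"
  \<comment> \<open>The coordinate second derivative, expressed through the form \<open>H\<close>.
    Symmetry of \<open>H\<close> and \<open>D x\<close> then makes it symmetric, so that the
    component along \<open>w\<close> cancels in the curvature.\<close>
  define q' where "q' = (\<lambda>u v. H u v + q x (D x u v))"
  have q': "((\<lambda>y. q y v) has_derivative (\<lambda>u. q' u v)) (at x)" for v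
    using smooth_on_has_derivative(2)[OF p(1) S(2), of v] unfolding q'_def H_def q_def by simp
  have p': "(p has_derivative q x) (at x)"
    using smooth_on_has_derivative(1)[OF p(1) S(2)] unfolding q_def .
  have D': "((\<lambda>y. D y v w) has_derivative frechet_derivative (\<lambda>y. D y v w) (at x)) (at x)" for v w
    by (rule smooth_on_has_derivative(1)[OF D(3) S(2)])
  have G': "frechet_derivative (\<lambda>y. G y v w) (at x) u =
      frechet_derivative (\<lambda>y. D y v w) (at x) u - P *\<^sub>R (q' u v *\<^sub>R w + q' u w *\<^sub>R v)
        + (P * P * q x u) *\<^sub>R (q x v *\<^sub>R w + q x w *\<^sub>R v)" for u v w
  proof -
    have "((\<lambda>y. D y v w - inverse (p y) *\<^sub>R (q y v *\<^sub>R w + q y w *\<^sub>R v)) has_derivative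
        (\<lambda>u. frechet_derivative (\<lambda>y. D y v w) (at x) u -
          (inverse (p x) *\<^sub>R (q' u v *\<^sub>R w + q' u w *\<^sub>R v)
            + (- (inverse (p x) * q x u * inverse (p x))) *\<^sub>R (q x v *\<^sub>R w + q x w *\<^sub>R v)))) (at x)"
      by (intro has_derivative_diff has_derivative_scaleR has_derivative_add has_derivative_scaleR_left
          Deriv.has_derivative_inverse p' q' D' p(2))
    then have "((\<lambda>y. G y v w) has_derivative
        (\<lambda>u. frechet_derivative (\<lambda>y. D y v w) (at x) u -
          (inverse (p x) *\<^sub>R (q' u v *\<^sub>R w + q' u w *\<^sub>R v)
            + (- (inverse (p x) * q x u * inverse (p x))) *\<^sub>R (q x v *\<^sub>R w + q x w *\<^sub>R v)))) (at x)"
      by (rule has_derivative_transform_within_open[OF _ S]) (simp add: G(2))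
    from frechet_derivative_at[OF this, symmetric] show ?thesis
      by (simp add: P_def mult_ac)
  qed
  have lin: "linear (q x)"
    using p' has_derivative_linear by blast
  note q_lin = linear_add[OF lin] linear_diff[OF lin] linear_cmul[OF lin]
  note D_lin = bilinear_radd[OF D(1)] bilinear_rsub[OF D(1)] bilinear_rmul[OF D(1)]
  have Gx: "G x u v = D x u v - P *\<^sub>R (q x u *\<^sub>R v + q x v *\<^sub>R u)" for u v
    using G(2)[OF S(2)] by (simp add: P_def)
  have sym: "H v u = H u v" "D x v u = D x u v"
    using H D(2) by auto
  show ?thesis
    \<comment> \<open>Once expanded in components, this is a polynomial identity; the
      \<open>P * P\<close> terms from differentiating \<open>inverse (p y)\<close> cancel against
      those from composing \<open>G x\<close> with itself.\<close>
    unfolding riemann_eq[of D x, OF D(1)] riemann_eq[of G x, OF G(1), unfolded G'] Gx P_def[symmetric] q'_def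
    by (simp add: q_lin D_lin sym vec_eq_iff) (simp add: algebra_simps)
qed

section \<open>Changes of charts\<close>

context
  fixes X :: "'a topology" and A :: "('a, 'd::finite) chart set"
  assumes M: "smooth_manifold X A"
begin

lemma manifold_chart: "c \<in> A \<Longrightarrow> is_chart X c"
  using M unfolding smooth_manifold_def by blast

lemma openin_cdom: "c \<in> A \<Longrightarrow> openin X (cdom c)"
  using manifold_chart unfolding is_chart_def by blast

lemma cdom_Int_topspace: "c \<in> A \<Longrightarrow> cdom c \<inter> topspace X = cdom c"
  using openin_subset[OF openin_cdom] by blast

lemma pt_coord: "c \<in> A \<Longrightarrow> p \<in> cdom c \<Longrightarrow> pt c (coord c p) = p"
  unfolding pt_def by (rule inv_into_f_f[OF chart_inj_on[OF manifold_chart]])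

lemma open_chart_image: "c \<in> A \<Longrightarrow> openin X S \<Longrightarrow> open (coord c ` (cdom c \<inter> S))"
  by (intro chart_open_image[OF manifold_chart] openin_Int openin_cdom) auto

lemma smooth_transition:
  "c \<in> A \<Longrightarrow> c' \<in> A \<Longrightarrow> smooth_on (coord c ` (cdom c \<inter> cdom c')) (transition c c')"
  using M unfolding smooth_manifold_def compatible_def by blast

lemma transition_has_derivative:
  assumes "c \<in> A" "c' \<in> A" "p \<in> cdom c" "p \<in> cdom c'"
  shows "(transition c c' has_derivative dtrans c c' (coord c p)) (at (coord c p))"
  using smooth_on_has_derivative(1)[OF smooth_transition[OF assms(1,2)]] assms by blast

lemma transition_coord:
  "c \<in> A \<Longrightarrow> p \<in> cdom c \<Longrightarrow> transition c c' (coord c p) = coord c' p"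
  by (simp add: transition_def pt_coord)

text \<open>The transitions compose on the triple overlap, whose image is open, so the chain rule
  may be applied at \<open>coord c p\<close>.\<close>

lemma dtrans_compose:
  assumes "c \<in> A" "c' \<in> A" "a \<in> A" "p \<in> cdom c" "p \<in> cdom c'" "p \<in> cdom a"
  shows "dtrans c a (coord c p) = dtrans c' a (coord c' p) \<circ> dtrans c c' (coord c p)"
proof -
  let ?S = "coord c ` (cdom c \<inter> (cdom c' \<inter> cdom a))"
  have "((\<lambda>x. transition c' a (transition c c' x)) has_derivative
      (\<lambda>v. dtrans c' a (coord c' p) (dtrans c c' (coord c p) v))) (at (coord c p))"
    using transition_has_derivative[of c' a p] assms
    by (intro has_derivative_compose[OF transition_has_derivative]) (auto simp: transition_coord)
  then have "(transition c a has_derivative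
      (\<lambda>v. dtrans c' a (coord c' p) (dtrans c c' (coord c p) v))) (at (coord c p))"
  proof (rule has_derivative_transform_within_open)
    show "open ?S"
      by (intro open_chart_image openin_Int openin_cdom assms)
    show "transition c' a (transition c c' x) = transition c a x" if "x \<in> ?S" for x
      using that assms by (auto simp: transition_coord)
  qed (use assms in blast)
  from frechet_derivative_at[OF this, symmetric] show ?thesis
    by (simp add: comp_def)
qed

lemma dtrans_self:
  assumes "c \<in> A" "p \<in> cdom c"
  shows "dtrans c c (coord c p) = id"
proof -
  have "(transition c c has_derivative id) (at (coord c p))"
  proof (rule has_derivative_transform_within_open[OF has_derivative_id])
    show "open (coord c ` (cdom c \<inter> cdom c))"
      by (intro open_chart_image openin_cdom assms)
  qed (use assms in \<open>auto simp: transition_coord\<close>)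
  from frechet_derivative_at[OF this] show ?thesis by simp
qed

lemma linear_dtrans:
  assumes "c \<in> A" "c' \<in> A" "p \<in> cdom c" "p \<in> cdom c'"
  shows "linear (dtrans c c' (coord c p))"
  using transition_has_derivative[OF assms] has_derivative_linear by blast

section \<open>Volume forms of charts\<close>

lemma chart_volume_transition:
  assumes "c \<in> A" "c' \<in> A" "a \<in> A" "p \<in> cdom c" "p \<in> cdom c'" "p \<in> cdom a"
  shows "chart_volume a c (coord c p) =
    det (matrix (dtrans c c' (coord c p))) * chart_volume a c' (coord c' p)"
  using assms unfolding chart_volume_def dtrans_compose[OF assms]
  by (subst matrix_compose) (auto simp: det_mul intro: linear_dtrans)

text \<open>Going from \<open>a\<close> to \<open>c\<close> and back is the identity; its
  determinant 1 has the value in question as a factor.\<close>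

lemma chart_volume_nonzero:
  assumes "c \<in> A" "a \<in> A" "p \<in> cdom c" "p \<in> cdom a"
  shows "chart_volume a c (coord c p) \<noteq> 0"
  using chart_volume_transition[of a c a p] dtrans_self[of a p] assms
  by (auto simp: chart_volume_def matrix_id)

lemma volume_form_on_chart_volume_divide:
  assumes a: "a \<in> A" and f: "smooth_fun_on A (topspace X) f" "\<And>p. p \<in> topspace X \<Longrightarrow> f p \<noteq> 0"
  shows "volume_form_on A (cdom a) (\<lambda>c x. chart_volume a c x / f (pt c x) ^ n)"
  unfolding volume_form_on_def
proof (intro conjI ballI)
  have f0: "f p \<noteq> 0" if "p \<in> cdom a" for p
    using f(2) openin_subset[OF openin_cdom[OF a]] that by blast
  fix c assume c: "c \<in> A"
  let ?S = "coord c ` (cdom c \<inter> cdom a)"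
  have S: "open ?S"
    by (intro open_chart_image openin_cdom a c)
  have "smooth_on (coord c ` (cdom c \<inter> topspace X)) (\<lambda>x. f (pt c x))"
    using f(1) c unfolding smooth_fun_on_def by blast
  then have "smooth_on ?S (\<lambda>x. f (pt c x))"
    by (rule smooth_on_subset) (use cdom_Int_topspace[OF c] in auto)
  then show "smooth_on ?S (\<lambda>x. chart_volume a c x / f (pt c x) ^ n)"
    unfolding chart_volume_def
    by (intro smooth_on_divide smooth_on_power S smooth_on_det_derivative smooth_transition a c)
      (auto simp: pt_coord c f0)
  show "chart_volume a c x / f (pt c x) ^ n \<noteq> 0" if "x \<in> ?S" for x
    using that c a by (auto simp: pt_coord f0 chart_volume_nonzero)
  fix c' x assume c': "c' \<in> A" and x: "x \<in> coord c ` (cdom c \<inter> cdom c' \<inter> cdom a)"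
  then obtain p where p: "x = coord c p" "p \<in> cdom c" "p \<in> cdom c'" "p \<in> cdom a"
    by blast
  show "chart_volume a c x / f (pt c x) ^ n =
      det (matrix (dtrans c c' x)) * (chart_volume a c' (transition c c' x) / f (pt c' (transition c c' x)) ^ n)"
    using p c c' a by (simp add: transition_coord pt_coord chart_volume_transition[of c c' a p])
qed

section \<open>Rescaled metrics and conformal classes\<close>

lemma metric_on_scale:
  assumes g: "metric_on A (topspace X) g" and f: "smooth_fun_on A (topspace X) f"
    "\<And>p. p \<in> topspace X \<Longrightarrow> f p \<noteq> 0"
  shows "metric_on A (topspace X) (scale f g)"
proof -
  have f0: "f (pt c x) \<noteq> 0" if "c \<in> A" "x \<in> coord c ` (cdom c \<inter> topspace X)" for c x
    using that f(2) by (auto simp: pt_coord)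
  have tr: "f (pt c' (transition c c' x)) = f (pt c x)"
    if "c \<in> A" "c' \<in> A" "x \<in> coord c ` (cdom c \<inter> cdom c' \<inter> topspace X)" for c c' x
    using that by (auto simp: pt_coord transition_coord)
  have bil: "bilinear (\<lambda>v w. k * h v w)" if "bilinear h" for k and h :: "real^'d \<Rightarrow> real^'d \<Rightarrow> real"
    using that unfolding bilinear_def linear_iff by (simp add: algebra_simps)
  have "tensor2_field A (topspace X) (scale f g)"
    unfolding tensor2_field_def
  proof (intro conjI ballI allI)
    fix c assume c: "c \<in> A"
    show "bilinear (scale f g c x)" if "x \<in> coord c ` (cdom c \<inter> topspace X)" for x
      using g c that unfolding metric_on_def tensor2_field_def scale_def by (blast intro: bil)
    show "smooth_on (coord c ` (cdom c \<inter> topspace X)) (\<lambda>x. scale f g c x v w)" for v w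
      unfolding scale_def using g f(1) c
      by (intro smooth_on_mult open_chart_image openin_topspace)
        (auto simp: metric_on_def tensor2_field_def smooth_fun_on_def)
    fix c' x v w assume c': "c' \<in> A" and x: "x \<in> coord c ` (cdom c \<inter> cdom c' \<inter> topspace X)"
    have "g c x v w = g c' (transition c c' x) (dtrans c c' x v) (dtrans c c' x w)"
      using g c c' x unfolding metric_on_def tensor2_field_def by blast
    then show "scale f g c x v w =
        scale f g c' (transition c c' x) (dtrans c c' x v) (dtrans c c' x w)"
      by (simp only: scale_def tr[OF c c' x])
  qed
  \<comment> \<open>Nondegeneracy survives any nonzero factor; no sign is required, the metrics
    being pseudo-Riemannian.\<close>
  then show ?thesis
    using g f0 unfolding metric_on_def scale_def by simp
qed

lemma same_conformal_classI:
  assumes "metric_on A (topspace X) g" "metric_on A (topspace X) h"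
    and "\<And>p. p \<in> topspace X \<Longrightarrow> 0 < f p"
    and "\<And>c p v w. c \<in> A \<Longrightarrow> p \<in> cdom c \<Longrightarrow> p \<in> topspace X \<Longrightarrow>
      h c (coord c p) v w = f p * g c (coord c p) v w"
  shows "same_conformal_class A (topspace X) g h"
  using assms unfolding same_conformal_class_def eq_tensor2_on_def scale_def
  by (auto simp: pt_coord)

end

section \<open>Hybrid connections\<close>

text \<open>Testing the condition on the constant field \<open>v\<close> removes the derivative from
  both covariant derivatives and leaves the Christoffel maps.\<close>

lemma hybrid_potential_christoffel:
  assumes "hybrid_potential X A D g G \<psi>" "c \<in> A" "open (coord c ` cdom c)" "x \<in> coord c ` cdom c"
  shows "G c x u v = D c x u v
    - (differential \<psi> c x u *\<^sub>R v + differential \<psi> c x v *\<^sub>R u) /\<^sub>R \<psi> (pt c x)"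
proof -
  have "covd (G c) (\<lambda>_. u) (\<lambda>_. v) x = covd (D c) (\<lambda>_. u) (\<lambda>_. v) x
      - (differential \<psi> c x u *\<^sub>R v + differential \<psi> c x v *\<^sub>R u) /\<^sub>R \<psi> (pt c x)"
    using assms smooth_on_const[OF assms(3)] unfolding hybrid_potential_def by blast
  then show ?thesis
    by (simp add: covd_def)
qed

section \<open>Ricci tensor of a hybrid connection\<close>

lemma ricci_hybrid:
  fixes D nabla :: "('a, 'd::finite) connection"
  assumes aff: "affine_manifold X A D" and g: "metric_on A (topspace X) g"
    and nabla: "is_connection A nabla" and pot: "hybrid_potential X A D g nabla \<psi>"
    and c: "c \<in> A" and x: "x \<in> coord c ` cdom c"
  shows "ricci nabla c x v w = (real CARD('d) - 1) / \<psi> (pt c x) * g c x v w"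
proof -
  have M: "smooth_manifold X A" and D: "is_connection A D" "torsion_free A D" "zero_curvature A D"
    using aff unfolding affine_manifold_def by auto
  define S where "S = coord c ` cdom c"
  define p where "p = (\<lambda>y. \<psi> (pt c y))"
  have S: "open S" "x \<in> S" "S = coord c ` (cdom c \<inter> topspace X)"
    using open_chart_image[OF M c openin_topspace] x
    by (auto simp: S_def cdom_Int_topspace[OF M c])
  have hess: "hessian D \<psi> c x u v = g c x u v" for u v
    using pot c S unfolding hybrid_potential_def eq_tensor2_on_def by auto
  have p: "smooth_on S p" "p x \<noteq> 0"
    using pot c S unfolding hybrid_potential_def smooth_fun_on_def p_def
    by (auto simp: pt_coord[OF M])
  have bil_D: "bilinear (D c x)" "\<And>u v. D c x u v = D c x v u"
      "\<And>u v. smooth_on S (\<lambda>y. D c y u v)" and bil_nabla: "bilinear (nabla c x)"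
    using D nabla c x unfolding is_connection_def torsion_free_def torsion_tensor_eq S_def by auto
  have nabla_eq: "nabla c y u v = D c y u v -
      (frechet_derivative p (at y) u *\<^sub>R v + frechet_derivative p (at y) v *\<^sub>R u) /\<^sub>R p y"
    if "y \<in> S" for y u v
    using hybrid_potential_christoffel[OF pot c, of y u v] that S(1)
    unfolding S_def p_def differential_def by blast
  \<comment> \<open>The form \<open>H\<close> of the projective change is the coordinate Hessian
    with its Christoffel correction, so \<open>unfolded H\<close> below puts the metric in its
    place.\<close>
  have H: "frechet_derivative (\<lambda>y. frechet_derivative p (at y) v) (at x) u
      - frechet_derivative p (at x) (D c x u v) = g c x u v" for u v
    using hess[of u v] unfolding hessian_def differential_def p_def by simp
  have g_sym: "g c x u v = g c x v u" and bil: "bilinear (g c x)" for u v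
    using g c S unfolding metric_on_def tensor2_field_def by auto
  have R: "riemann (nabla c) x u v w =
      riemann (D c) x u v w + (g c x v w *\<^sub>R u - g c x u w *\<^sub>R v) /\<^sub>R p x" for u v w
    by (rule riemann_projective_change[OF S(1,2) p bil_D bil_nabla nabla_eq, unfolded H])
      (assumption | rule g_sym)+
  have "riemann (D c) x u v w = 0" for u v w
    using D(3) c x unfolding zero_curvature_def by blast
  then have "ricci nabla c x v w =
      (\<Sum>i\<in>UNIV. (g c x v w - g c x (axis i 1) w * v $ i) / p x)"
    by (simp add: ricci_def R divide_inverse mult.commute)
  also have "\<dots> = (real CARD('d) * g c x v w - (\<Sum>i\<in>UNIV. g c x (axis i 1) w * v $ i)) / p x"
    by (simp add: sum_divide_distrib[symmetric] sum_subtractf)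
  \<comment> \<open>The second term of the trace reassembles \<open>v\<close> from its components:
    one copy of \<open>g c x v w\<close> is subtracted from \<open>CARD('d)\<close> copies.\<close>
  also have "(\<Sum>i\<in>UNIV. g c x (axis i 1) w * v $ i) = g c x (\<Sum>i\<in>UNIV. v $ i *\<^sub>R axis i 1) w"
  proof -
    have lin: "linear (\<lambda>u. g c x u w)"
      using bil unfolding bilinear_def by blast
    show ?thesis
      by (simp add: linear_sum[OF lin] linear_cmul[OF lin] mult.commute)
  qed
  also have "(\<Sum>i\<in>UNIV. v $ i *\<^sub>R axis i 1) = v"
    using basis_expansion[of v] by (simp add: scalar_mult_eq_scaleR)
  finally show ?thesis
    by (simp add: p_def field_simps)
qed

section \<open>The volume form preserved by a hybrid connection\<close>

lemma det_linear_rows: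
  fixes f :: "real^'d::finite \<Rightarrow> real^'d"
  assumes "linear f"
  shows "det (\<chi> i. f (v i)) = det (matrix f) * det (\<chi> i. v i)"
proof -
  have "f u = matrix f *v u" for u
    by (rule matrix_works[symmetric]) (use assms in \<open>simp add: linear_def scalar_mult_eq_scaleR\<close>)
  \<comment> \<open>The vectors are rows, as in \<open>volform_apply\<close>, so \<open>f\<close>
    acts by the transposed matrix on the right.\<close>
  then have "(\<chi> i. f (v i)) = (\<chi> i. v i) ** transpose (matrix f)"
    by (simp add: vec_eq_iff matrix_matrix_mult_def transpose_def matrix_vector_mult_def mult.commute)
  then show ?thesis
    by (simp add: det_mul det_transpose)
qed

text \<open>Infinitesimal parallel transport multiplies the frame \<open>V\<close> by a matrix of trace
  \<open>(d + 1) d(log \<psi>)\<close>, whence the exponent \<open>d + 1\<close>.\<close>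
lemma det_parallel_frame_constant:
  fixes p :: "real^'d::finite \<Rightarrow> real"
  assumes I: "open I" "is_interval I"
    and y: "\<And>t. t \<in> I \<Longrightarrow> (y has_vector_derivative y' t) (at t)"
    and p: "\<And>t. t \<in> I \<Longrightarrow> p differentiable (at (y t))" "\<And>t. t \<in> I \<Longrightarrow> p (y t) \<noteq> 0"
    and V: "\<And>i t. t \<in> I \<Longrightarrow> (V i has_vector_derivative
      (frechet_derivative p (at (y t)) (y' t) *\<^sub>R V i t
        + frechet_derivative p (at (y t)) (V i t) *\<^sub>R y' t) /\<^sub>R p (y t)) (at t)"
  shows "\<exists>k. \<forall>t\<in>I. det (\<chi> i. V i t) / p (y t) ^ (CARD('d) + 1) = k"
proof (rule has_field_derivative_zero_constant)
  show "convex I"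
    using I(2) by (simp add: is_interval_convex)
  fix t assume t: "t \<in> I"
  define q where "q = frechet_derivative p (at (y t))"
  define P where "P = p (y t)"
  define W where "W = (\<chi> i. V i t)"
  \<comment> \<open>Acting on row vectors from the right, \<open>M\<close> is a multiple of the
    identity plus a matrix of rank at most one.\<close>
  define M :: "real^'d^'d" where
    "M = (\<chi> k j. (q (y' t) * (if k = j then 1 else 0) + q (axis k 1) * y' t $ j) / P)"
  have P: "P \<noteq> 0"
    using p(2)[OF t] by (simp add: P_def)
  have q: "q u = (\<Sum>i\<in>UNIV. u $ i * q (axis i 1))" for u
    unfolding q_def by (rule frechet_derivative_sum_axis[OF p(1)[OF t]])
  have row: "(q (y' t) *\<^sub>R V i t + q (V i t) *\<^sub>R y' t) /\<^sub>R P = (W ** M) $ i" for i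
  proof -
    have "(W ** M) $ i $ j = (q (y' t) * V i t $ j + q (V i t) * y' t $ j) / P" for j
    proof -
      have "(W ** M) $ i $ j = (\<Sum>k\<in>UNIV. (q (y' t) * (V i t $ k * (if k = j then 1 else 0))
          + V i t $ k * q (axis k 1) * y' t $ j) / P)"
        by (simp add: W_def M_def matrix_matrix_mult_def algebra_simps)
      also have "\<dots> = (q (y' t) * (\<Sum>k\<in>UNIV. V i t $ k * (if k = j then 1 else 0))
          + (\<Sum>k\<in>UNIV. V i t $ k * q (axis k 1)) * y' t $ j) / P"
        by (simp only: sum_divide_distrib[symmetric] sum.distrib sum_distrib_left sum_distrib_right)
      also have "\<dots> = (q (y' t) * V i t $ j + q (V i t) * y' t $ j) / P"
        unfolding q[of "V i t", symmetric] by (simp add: if_distrib cong: if_cong)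
      finally show ?thesis .
    qed
    then show ?thesis
      by (simp add: vec_eq_iff divide_inverse mult.commute)
  qed
  \<comment> \<open>The scalar part contributes \<open>CARD('d)\<close> copies of
    \<open>q (y' t)\<close>, the other part one more.\<close>
  have "trace M = (real CARD('d) * q (y' t) + (\<Sum>i\<in>UNIV. y' t $ i * q (axis i 1))) / P"
    by (simp add: trace_def M_def sum_divide_distrib[symmetric] sum.distrib mult.commute)
  then have trace: "trace M = (real CARD('d) + 1) * q (y' t) / P"
    unfolding q[symmetric] by (simp add: algebra_simps)
  have "((\<lambda>t. (\<chi> i. V i t) $ i) has_vector_derivative (W ** M) $ i) (at t)" for i
    using V[OF t, of i] unfolding row[symmetric] by (simp add: q_def P_def)
  from has_real_derivative_det[OF this]
  have "((\<lambda>t. det (\<chi> i. V i t)) has_real_derivative trace M * det W) (at t)"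
    unfolding W_def[symmetric] sum_det_replace_row_mult .
  moreover have "((\<lambda>t. p (y t)) has_real_derivative q (y' t)) (at t)"
  proof (rule has_derivative_imp_has_field_derivative)
    show "((\<lambda>t. p (y t)) has_derivative (\<lambda>s. q (s *\<^sub>R y' t))) (at t)"
      using has_derivative_compose[OF y[OF t, unfolded has_vector_derivative_def]]
        p(1)[OF t, unfolded frechet_derivative_works] unfolding q_def by blast
    show "s * q (y' t) = q (s *\<^sub>R y' t)" for s
      using linear_cmul[OF linear_frechet_derivative[OF p(1)[OF t]]] by (simp add: q_def)
  qed
  \<comment> \<open>The exponent is put in the form \<open>Suc CARD('d)\<close> for the power rule.
    The numerator of the quotient rule vanishes by the value of the trace.\<close>
  ultimately have deriv: "((\<lambda>t. det (\<chi> i. V i t) / p (y t) ^ Suc CARD('d)) has_real_derivative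
      (trace M * det W * P ^ Suc CARD('d)
        - det W * ((1 + real CARD('d)) * (q (y' t) * P ^ CARD('d))))
      / (P ^ Suc CARD('d) * P ^ Suc CARD('d))) (at t)"
    using P unfolding P_def W_def by (intro DERIV_divide DERIV_power_Suc) auto
  have "trace M * det W * P ^ Suc CARD('d)
      - det W * ((1 + real CARD('d)) * (q (y' t) * P ^ CARD('d))) = 0"
    using P by (simp add: trace)
  with deriv have "((\<lambda>t. det (\<chi> i. V i t) / p (y t) ^ (CARD('d) + 1)) has_real_derivative 0) (at t)"
    by (simp only: div_0 Suc_eq_plus1)
  then show "((\<lambda>t. det (\<chi> i. V i t) / p (y t) ^ (CARD('d) + 1)) has_real_derivative 0)
      (at t within I)"
    by (rule has_field_derivative_at_within)
qed

text \<open>The curve stays in \<open>cdom a\<close>, so its frame can be followed in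
  \<open>a\<close> alone. In another chart \<open>c\<close> the frame determinant changes by the
  Jacobian determinant, which is exactly \<open>chart_volume a c\<close>.\<close>

lemma preserves_chart_volume_divide:
  fixes D nabla :: "('a, 'd::finite) connection"
  assumes M: "smooth_manifold X A" and pot: "hybrid_potential X A D g nabla \<psi>"
    and a: "affine_chart A D a"
  shows "preserves_volume_form X A nabla (cdom a)
    (\<lambda>c x. chart_volume a c x / \<psi> (pt c x) ^ (CARD('d) + 1))"
  unfolding preserves_volume_form_def
proof (intro allI impI, elim conjE)
  fix I \<gamma> and V :: "'d \<Rightarrow> ('a, 'd) chart \<Rightarrow> real \<Rightarrow> real^'d"
  assume curve: "smooth_curve X A I \<gamma>" and sub: "\<gamma> ` I \<subseteq> cdom a"
    and par: "\<forall>i. parallel_field A nabla I \<gamma> (V i)"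
  have V_trans: "V i c' t = dtrans c c' (coord c (\<gamma> t)) (V i c t)"
    if "c \<in> A" "c' \<in> A" "t \<in> I" "\<gamma> t \<in> cdom c" "\<gamma> t \<in> cdom c'" for i c c' t
    using spec[OF par, of i] that unfolding parallel_field_def by blast
  have V_deriv: "(V i c has_vector_derivative - nabla c (coord c (\<gamma> t)) (velocity c \<gamma> t) (V i c t)) (at t)"
    if "c \<in> A" "t \<in> I" "\<gamma> t \<in> cdom c" for i c t
    using spec[OF par, of i] that unfolding parallel_field_def by blast
  have aA: "a \<in> A" and Da: "\<And>x v w. x \<in> coord a ` cdom a \<Longrightarrow> D a x v w = 0"
    using a unfolding affine_chart_def by auto
  define p where "p = (\<lambda>x. \<psi> (pt a x))"
  define y where "y = (\<lambda>t. coord a (\<gamma> t))"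
  have \<gamma>: "\<gamma> t \<in> cdom a" "y t \<in> coord a ` cdom a" "\<gamma> t \<in> topspace X" if "t \<in> I" for t
    using sub that openin_subset[OF openin_cdom[OF M aA]] by (auto simp: y_def)
  have py: "p (y t) = \<psi> (\<gamma> t)" if "t \<in> I" for t
    using \<gamma>(1)[OF that] by (simp add: p_def y_def pt_coord[OF M aA])
  have smooth_p: "smooth_on (coord a ` cdom a) p"
    using pot aA cdom_Int_topspace[OF M aA]
    unfolding hybrid_potential_def smooth_fun_on_def p_def by auto
  have op: "open (coord a ` cdom a)"
    using open_chart_image[OF M aA openin_topspace] by (simp add: cdom_Int_topspace[OF M aA])
  have "\<exists>k. \<forall>t\<in>I. det (\<chi> i. V i a t) / p (y t) ^ (CARD('d) + 1) = k"
  proof (rule det_parallel_frame_constant)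
    show "open I" "is_interval I"
      using curve unfolding smooth_curve_def open_interval_def by auto
    fix t assume t: "t \<in> I"
    have "{t \<in> I. \<gamma> t \<in> cdom a} = I"
      using \<gamma>(1) by blast
    then have "smooth_on I y"
      using curve aA unfolding smooth_curve_def y_def by auto
    then show "(y has_vector_derivative velocity a \<gamma> t) (at t)"
      using smooth_on_differentiable(1)[OF _ t] unfolding velocity_def y_def vector_derivative_works
      by blast
    show "p differentiable (at (y t))"
      by (rule smooth_on_differentiable(1)[OF smooth_p \<gamma>(2)[OF t]])
    show "p (y t) \<noteq> 0"
      using pot \<gamma>(3)[OF t] py[OF t] unfolding hybrid_potential_def by auto
    fix i
    have "(V i a has_vector_derivative - nabla a (y t) (velocity a \<gamma> t) (V i a t)) (at t)"
      unfolding y_def by (rule V_deriv[OF aA t \<gamma>(1)[OF t]])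
    \<comment> \<open>The minus sign of the transport equation cancels the one in front of the
      projective term, and \<open>D\<close> vanishes in the affine chart.\<close>
    then show "(V i a has_vector_derivative
      (frechet_derivative p (at (y t)) (velocity a \<gamma> t) *\<^sub>R V i a t
        + frechet_derivative p (at (y t)) (V i a t) *\<^sub>R velocity a \<gamma> t) /\<^sub>R p (y t)) (at t)"
      unfolding hybrid_potential_christoffel[OF pot aA op \<gamma>(2)[OF t]] Da[OF \<gamma>(2)[OF t]]
      by (simp add: differential_def p_def)
  qed
  then obtain k where const: "\<forall>t\<in>I. det (\<chi> i. V i a t) / p (y t) ^ (CARD('d) + 1) = k"
    by blast
  have k: "det (\<chi> i. V i a t) / \<psi> (\<gamma> t) ^ (CARD('d) + 1) = k" if "t \<in> I" for t
    using bspec[OF const that] unfolding py[OF that] .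
  have "volform_apply (\<lambda>c x. chart_volume a c x / \<psi> (pt c x) ^ (CARD('d) + 1)) c (coord c (\<gamma> t))
      (\<lambda>i. V i c t) = k" if t: "t \<in> I" and c: "c \<in> A" "\<gamma> t \<in> cdom c" for t c
  proof -
    have "V i a t = dtrans c a (coord c (\<gamma> t)) (V i c t)" for i
      by (rule V_trans[OF c(1) aA t c(2) \<gamma>(1)[OF t]])
    then show ?thesis
      using k[OF t] det_linear_rows[OF linear_dtrans[OF M c(1) aA c(2) \<gamma>(1)[OF t]], of "\<lambda>i. V i c t"]
      by (simp add: volform_apply_def chart_volume_def pt_coord[OF M c])
  qed
  then show "\<exists>k. \<forall>t\<in>I. \<forall>c\<in>A. \<gamma> t \<in> cdom c \<longrightarrow>
      volform_apply (\<lambda>c x. chart_volume a c x / \<psi> (pt c x) ^ (CARD('d) + 1)) c (coord c (\<gamma> t))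
        (\<lambda>i. V i c t) = k"
    by (intro exI[of _ k]) simp
qed

theorem theorem1p11:
  fixes X :: "'a topology" and A :: "('a, 'd::finite) chart set"
    and D nabla :: "('a, 'd) connection" and g :: "('a, 'd) tensor2" and \<psi> :: "'a \<Rightarrow> real"
  assumes "pseudo_euclidean_manifold X A D g"
    and "hybrid_connection X A D g nabla"
    and "hybrid_potential X A D g nabla \<psi>"
  shows
    "let N = {p \<in> topspace X. \<psi> p \<noteq> 0};
         g_abs = scale (\<lambda>p. (real CARD('d) - 1) / \<bar>\<psi> p\<bar>) g;
         g_iso = isochrone_metric \<psi> g
     in same_conformal_class A N g g_abs \<and>
        same_conformal_class A N g g_iso \<and>
        same_conformal_class A N g_abs g_iso \<and>
        eq_tensor2_on A {p \<in> topspace X. \<psi> p > 0} g_abs (ricci nabla) \<and>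
        eq_tensor2_on A {p \<in> topspace X. \<psi> p < 0} g_abs (scale (\<lambda>_. - 1) (ricci nabla)) \<and>
        (\<forall>a. affine_chart A D a \<longrightarrow>
           (let \<omega> = (\<lambda>c x. chart_volume a c x / \<psi> (pt c x) ^ (CARD('d) + 1))
            in volume_form_on A (cdom a) \<omega> \<and> preserves_volume_form X A nabla (cdom a) \<omega>))"
proof -
  have aff: "affine_manifold X A D" and d: "CARD('d) \<ge> 2" and g: "metric_on A (topspace X) g"
    using assms(1) unfolding pseudo_euclidean_manifold_def hessian_manifold_def by auto
  then have M: "smooth_manifold X A"
    unfolding affine_manifold_def by blast
  have nabla: "is_connection A nabla"
    using assms(2) unfolding hybrid_connection_def by blast
  have nz: "\<psi> p \<noteq> 0" if "p \<in> topspace X" for p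
    using assms(3) that unfolding hybrid_potential_def by blast
  have sm: "smooth_fun_on A (topspace X) \<psi>"
    using assms(3) unfolding hybrid_potential_def by blast
  define g_abs where "g_abs = scale (\<lambda>p. (real CARD('d) - 1) / \<bar>\<psi> p\<bar>) g"
  define g_iso where "g_iso = isochrone_metric \<psi> g"
  have N: "{p \<in> topspace X. \<psi> p \<noteq> 0} = topspace X"
    using nz by blast
  have op: "open (coord c ` (cdom c \<inter> topspace X))" if "c \<in> A" for c
    by (rule open_chart_image[OF M that openin_topspace])
  have sm': "smooth_on (coord c ` (cdom c \<inter> topspace X)) (\<lambda>x. \<psi> (pt c x))"
      "\<And>x. x \<in> coord c ` (cdom c \<inter> topspace X) \<Longrightarrow> \<psi> (pt c x) \<noteq> 0" if "c \<in> A" for c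
    using sm that nz by (auto simp: smooth_fun_on_def pt_coord[OF M])
  have g_abs: "metric_on A (topspace X) g_abs"
    unfolding g_abs_def
  proof (rule metric_on_scale[OF M g])
    show "smooth_fun_on A (topspace X) (\<lambda>p. (real CARD('d) - 1) / \<bar>\<psi> p\<bar>)"
      unfolding smooth_fun_on_def
      using sm' by (auto intro!: smooth_on_divide smooth_on_abs smooth_on_const op)
  qed (use nz d in auto)
  have g_iso: "metric_on A (topspace X) g_iso"
    unfolding g_iso_def isochrone_metric_def
  proof (rule metric_on_scale[OF M g])
    show "smooth_fun_on A (topspace X) (\<lambda>p. 1 / \<psi> p ^ 4)"
      unfolding smooth_fun_on_def
      using sm' by (auto intro!: smooth_on_divide smooth_on_power smooth_on_const op)
  qed (use nz in auto)
  have "same_conformal_class A (topspace X) g g_abs"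
    by (rule same_conformal_classI[OF M g g_abs, where f = "\<lambda>p. (real CARD('d) - 1) / \<bar>\<psi> p\<bar>"])
      (use nz d in \<open>auto simp: g_abs_def scale_def pt_coord[OF M]\<close>)
  moreover have "same_conformal_class A (topspace X) g g_iso"
    by (rule same_conformal_classI[OF M g g_iso, where f = "\<lambda>p. 1 / \<psi> p ^ 4"])
      (use nz in \<open>auto simp: g_iso_def isochrone_metric_def scale_def pt_coord[OF M] zero_less_power_eq\<close>)
  \<comment> \<open>The factor is the quotient of the two scalings of \<open>g\<close>; it is
    positive because the dimension is at least 2.\<close>
  moreover have "same_conformal_class A (topspace X) g_abs g_iso"
    by (rule same_conformal_classI[OF M g_abs g_iso,
          where f = "\<lambda>p. \<bar>\<psi> p\<bar> / ((real CARD('d) - 1) * \<psi> p ^ 4)"])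
      (use nz d in \<open>auto simp: g_abs_def g_iso_def isochrone_metric_def scale_def pt_coord[OF M]
        zero_less_power_eq intro!: divide_pos_pos mult_pos_pos\<close>)
  \<comment> \<open>A single formula for both signs: |\<psi>| is \<psi> or its opposite, which
    yields the two Ricci identities.\<close>
  moreover have "ricci nabla c x v w = (real CARD('d) - 1) / \<psi> (pt c x) * g c x v w"
    if "c \<in> A" "x \<in> coord c ` cdom c" for c x v w
    by (rule ricci_hybrid[OF aff g nabla assms(3) that])
  then have "eq_tensor2_on A {p \<in> topspace X. \<psi> p > 0} g_abs (ricci nabla)"
      "eq_tensor2_on A {p \<in> topspace X. \<psi> p < 0} g_abs (scale (\<lambda>_. - 1) (ricci nabla))"
    by (auto simp: eq_tensor2_on_def g_abs_def scale_def pt_coord[OF M])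
  moreover have "volume_form_on A (cdom a) (\<lambda>c x. chart_volume a c x / \<psi> (pt c x) ^ (CARD('d) + 1))"
      "preserves_volume_form X A nabla (cdom a) (\<lambda>c x. chart_volume a c x / \<psi> (pt c x) ^ (CARD('d) + 1))"
    if "affine_chart A D a" for a
    using volume_form_on_chart_volume_divide[OF M _ sm nz] preserves_chart_volume_divide[OF M assms(3) that]
      that unfolding affine_chart_def by blast+
  ultimately show ?thesis
    unfolding Let_def N g_abs_def[symmetric] g_iso_def[symmetric] by blast
qed

end
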